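(* Let $Q$ be a loop that is both an AIM loop and an LC loop. Then $N(Q)$ is a normal subloop of $Q$, the factor loop $Q/N(Q)$ is an abelian group, and $Q/Z(Q)$ is a group. In particular, $Q$ is centrally nilpotent of class at most $3$.
   Context: A loop $(Q,\cdot)$ is a set with a binary operation and an element $1$ with $1x=x1=x$ such that every left translation $L_x: y\mapsto xy$ and right translation $R_x: y\mapsto yx$ is a bijection of $Q$; left and right division are $x\backslash y = yL_x^{-1}$ and $x/y = xR_y^{-1}$. A subloop is a nonempty subset closed under $\cdot,\backslash,/$. The multiplication group is $\mathrm{Mlt}(Q)=\langle L_x,R_x : x\in Q\rangle$ and the inner mapping group is $\mathrm{Inn}(Q)=\{\varphi\in\mathrm{Mlt}(Q): 1\varphi=1\}$. $Q$ is an AIM loop if $\mathrm{Inn}(Q)$ is abelian. A subloop $S$ is normal if $S\varphi=S$ for all $\varphi\in\mathrm{Inn}(Q)$; for normal $S$, $Q/S$ is the loop of cosets $xS$ with $xS\cdot yS=(xy)S$. $Q$ is an LC loop if $x(x(yz))=(x(xy))z$ for all $x,y,z\in Q$. The nucleus is $N(Q)=N_\lambda\cap N_\rho\cap N_\mu$ where $N_\lambda=\{a: ax\cdot y=a\cdot xy\ \forall x,y\}$, $N_\rho=\{a: xy\cdot a=x\cdot ya\ \forall x,y\}$, $N_\mu=\{a: xa\cdot y=x\cdot ay\ \forall x,y\}$. The commutant is $C(Q)=\{a: ax=xa\ \forall x\}$ and the center is $Z(Q)=C(Q)\cap N(Q)$ (always a normal subloop). Define $Z_0(Q)=\{1\}$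 and $Z_{i+1}(Q)$ as the preimage of $Z(Q/Z_i(Q))$ under the canonical projection $Q\to Q/Z_i(Q)$; $Q$ is (centrally) nilpotent of class $n$ if $Z_{n-1}(Q)\ne Q$ and $Z_n(Q)=Q$. *)

theory Defs
  imports Main
begin

definition is_loop :: "'a set \<Rightarrow> ('a \<Rightarrow> 'a \<Rightarrow> 'a) \<Rightarrow> 'a \<Rightarrow> bool" where
  "is_loop Q m e \<longleftrightarrow> e \<in> Q \<and> (\<forall>x\<in>Q. \<forall>y\<in>Q. m x y \<in> Q)
     \<and> (\<forall>x\<in>Q. m e x = x \<and> m x e = x)
     \<and> (\<forall>x\<in>Q. bij_betw (m x) Q Q)
     \<and> (\<forall>x\<in>Q. bij_betw (\<lambda>y. m y x) Q Q)"

definition ldiv :: "'a set \<Rightarrow> ('a \<Rightarrow> 'a \<Rightarrow> 'a) \<Rightarrow> 'a \<Rightarrow> 'a \<Rightarrow> 'a" where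
  "ldiv Q m x y = (THE z. z \<in> Q \<and> m x z = y)"

definition rdiv :: "'a set \<Rightarrow> ('a \<Rightarrow> 'a \<Rightarrow> 'a) \<Rightarrow> 'a \<Rightarrow> 'a \<Rightarrow> 'a" where
  "rdiv Q m x y = (THE z. z \<in> Q \<and> m z y = x)"

definition subloop :: "'a set \<Rightarrow> ('a \<Rightarrow> 'a \<Rightarrow> 'a) \<Rightarrow> 'a set \<Rightarrow> bool" where
  "subloop Q m S \<longleftrightarrow> S \<noteq> {} \<and> S \<subseteq> Q \<and>
     (\<forall>x\<in>S. \<forall>y\<in>S. m x y \<in> S \<and> ldiv Q m x y \<in> S \<and> rdiv Q m x y \<in> S)"

definition Ltr :: "'a set \<Rightarrow> ('a \<Rightarrow> 'a \<Rightarrow> 'a) \<Rightarrow> 'a \<Rightarrow> 'a \<Rightarrow> 'a" where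
  "Ltr Q m x = (\<lambda>y. if y \<in> Q then m x y else y)"

definition Rtr :: "'a set \<Rightarrow> ('a \<Rightarrow> 'a \<Rightarrow> 'a) \<Rightarrow> 'a \<Rightarrow> 'a \<Rightarrow> 'a" where
  "Rtr Q m x = (\<lambda>y. if y \<in> Q then m y x else y)"

definition perm_inv :: "'a set \<Rightarrow> ('a \<Rightarrow> 'a) \<Rightarrow> 'a \<Rightarrow> 'a" where
  "perm_inv Q f = (\<lambda>y. if y \<in> Q then inv_into Q f y else y)"

inductive_set Mlt :: "'a set \<Rightarrow> ('a \<Rightarrow> 'a \<Rightarrow> 'a) \<Rightarrow> ('a \<Rightarrow> 'a) set"
  for Q m where
  gen_L: "x \<in> Q \<Longrightarrow> Ltr Q m x \<in> Mlt Q m"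
| gen_R: "x \<in> Q \<Longrightarrow> Rtr Q m x \<in> Mlt Q m"
| comp: "f \<in> Mlt Q m \<Longrightarrow> g \<in> Mlt Q m \<Longrightarrow> g \<circ> f \<in> Mlt Q m"
| inv: "f \<in> Mlt Q m \<Longrightarrow> perm_inv Q f \<in> Mlt Q m"

definition Inn :: "'a set \<Rightarrow> ('a \<Rightarrow> 'a \<Rightarrow> 'a) \<Rightarrow> 'a \<Rightarrow> ('a \<Rightarrow> 'a) set" where
  "Inn Q m e = {\<phi> \<in> Mlt Q m. \<phi> e = e}"

definition AIM_loop :: "'a set \<Rightarrow> ('a \<Rightarrow> 'a \<Rightarrow> 'a) \<Rightarrow> 'a \<Rightarrow> bool" where
  "AIM_loop Q m e \<longleftrightarrow> is_loop Q m e \<and>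
     (\<forall>\<phi>\<in>Inn Q m e. \<forall>\<psi>\<in>Inn Q m e. \<phi> \<circ> \<psi> = \<psi> \<circ> \<phi>)"

definition LC_loop :: "'a set \<Rightarrow> ('a \<Rightarrow> 'a \<Rightarrow> 'a) \<Rightarrow> 'a \<Rightarrow> bool" where
  "LC_loop Q m e \<longleftrightarrow> is_loop Q m e \<and>
     (\<forall>x\<in>Q. \<forall>y\<in>Q. \<forall>z\<in>Q. m x (m x (m y z)) = m (m x (m x y)) z)"

definition normal_subloop :: "'a set \<Rightarrow> ('a \<Rightarrow> 'a \<Rightarrow> 'a) \<Rightarrow> 'a \<Rightarrow> 'a set \<Rightarrow> bool" where
  "normal_subloop Q m e S \<longleftrightarrow> subloop Q m S \<and> (\<forall>\<phi>\<in>Inn Q m e. \<phi> ` S = S)"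

definition lnuc :: "'a set \<Rightarrow> ('a \<Rightarrow> 'a \<Rightarrow> 'a) \<Rightarrow> 'a set" where
  "lnuc Q m = {a \<in> Q. \<forall>x\<in>Q. \<forall>y\<in>Q. m (m a x) y = m a (m x y)}"

definition rnuc :: "'a set \<Rightarrow> ('a \<Rightarrow> 'a \<Rightarrow> 'a) \<Rightarrow> 'a set" where
  "rnuc Q m = {a \<in> Q. \<forall>x\<in>Q. \<forall>y\<in>Q. m (m x y) a = m x (m y a)}"

definition mnuc :: "'a set \<Rightarrow> ('a \<Rightarrow> 'a \<Rightarrow> 'a) \<Rightarrow> 'a set" where
  "mnuc Q m = {a \<in> Q. \<forall>x\<in>Q. \<forall>y\<in>Q. m (m x a) y = m x (m a y)}"

definition nucleus :: "'a set \<Rightarrow> ('a \<Rightarrow> 'a \<Rightarrow> 'a) \<Rightarrow> 'a set" where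
  "nucleus Q m = lnuc Q m \<inter> rnuc Q m \<inter> mnuc Q m"

definition commutant :: "'a set \<Rightarrow> ('a \<Rightarrow> 'a \<Rightarrow> 'a) \<Rightarrow> 'a set" where
  "commutant Q m = {a \<in> Q. \<forall>x\<in>Q. m a x = m x a}"

definition center :: "'a set \<Rightarrow> ('a \<Rightarrow> 'a \<Rightarrow> 'a) \<Rightarrow> 'a set" where
  "center Q m = commutant Q m \<inter> nucleus Q m"

definition lcoset :: "('a \<Rightarrow> 'a \<Rightarrow> 'a) \<Rightarrow> 'a \<Rightarrow> 'a set \<Rightarrow> 'a set" where
  "lcoset m x S = (\<lambda>s. m x s) ` S"

definition qcarrier :: "'a set \<Rightarrow> ('a \<Rightarrow> 'a \<Rightarrow> 'a) \<Rightarrow> 'a set \<Rightarrow> 'a set set" where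
  "qcarrier Q m S = {lcoset m x S | x. x \<in> Q}"

definition qmult :: "('a \<Rightarrow> 'a \<Rightarrow> 'a) \<Rightarrow> 'a set \<Rightarrow> 'a set \<Rightarrow> 'a set \<Rightarrow> 'a set" where
  "qmult m S A B = lcoset m (m (SOME a. a \<in> A) (SOME b. b \<in> B)) S"

definition is_group_loop :: "'a set \<Rightarrow> ('a \<Rightarrow> 'a \<Rightarrow> 'a) \<Rightarrow> 'a \<Rightarrow> bool" where
  "is_group_loop Q m e \<longleftrightarrow> is_loop Q m e \<and>
     (\<forall>x\<in>Q. \<forall>y\<in>Q. \<forall>z\<in>Q. m (m x y) z = m x (m y z))"

definition is_abelian_group_loop :: "'a set \<Rightarrow> ('a \<Rightarrow> 'a \<Rightarrow> 'a) \<Rightarrow> 'a \<Rightarrow> bool" where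
  "is_abelian_group_loop Q m e \<longleftrightarrow> is_group_loop Q m e \<and>
     (\<forall>x\<in>Q. \<forall>y\<in>Q. m x y = m y x)"

fun upper_center :: "'a set \<Rightarrow> ('a \<Rightarrow> 'a \<Rightarrow> 'a) \<Rightarrow> 'a \<Rightarrow> nat \<Rightarrow> 'a set" where
  "upper_center Q m e 0 = {e}"
| "upper_center Q m e (Suc i) =
     {x \<in> Q. lcoset m x (upper_center Q m e i)
              \<in> center (qcarrier Q m (upper_center Q m e i)) (qmult m (upper_center Q m e i))}"

definition nilpotent_class_le :: "'a set \<Rightarrow> ('a \<Rightarrow> 'a \<Rightarrow> 'a) \<Rightarrow> 'a \<Rightarrow> nat \<Rightarrow> bool" where
  "nilpotent_class_le Q m e n \<longleftrightarrow> (\<exists>k\<le>n. upper_center Q m e k = Q)"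

end

theory Submission
  imports Defs
begin

text \<open>
  Write \<open>G\<close> for the multiplication group, additively, and \<open>H\<close> for the abelian inner mapping group.
  By the LC law, conjugation by \<open>L x\<close> negates the elements \<open>h x z \<in> H\<close>, which measure associators starting
  with \<open>x\<close>. As \<open>H\<close> is abelian, the elements \<open>p\<close> whose left translation centralises all \<open>h x z\<close> form a normal
  subloop; the relation obtained in this way is symmetric, its radical is the left nucleus \<open>M\<close>, and \<open>x\<close> becomes
  central modulo this subloop, so that every inner mapping involving \<open>x\<close> acts trivially there.

  Two consequences are drawn. First, an inner mapping that acts trivially modulo the subloop of \<open>a\<close> moves \<open>a\<close>
  only by an element of \<open>M\<close>; hence \<open>Q/M\<close> is right alternative, so it is an inverse property loop of exponent 2
  and therefore commutative. Secondly, nested associators are symmetric in their five arguments and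
  of order 2, while commutativity expresses one of them as the sum of two others; hence they vanish.
  So all associators lie in \<open>M\<close>, and as they commute with everything they are central. Comparing the
  action of commuting inner mappings then puts the commutators into the nucleus and, modulo the center, into the
  second center.
\<close>

definition conjg :: "'g::group_add \<Rightarrow> 'g \<Rightarrow> 'g" where
  "conjg f g = f + g - f"

lemmas group_simps = diff_conv_add_uminus minus_add add.assoc minus_minus left_minus right_minus
  add_0_left add_0_right minus_zero minus_add_cancel add_minus_cancel

lemma conjg_add: "conjg (f + g) k = conjg f (conjg g k)"
  by (simp only: conjg_def group_simps)

lemma conjg_diff: "conjg (f - g) k = conjg f (conjg (- g) k)"
  by (simp only: diff_conv_add_uminus conjg_add)

lemma conjg_plus: "conjg f (g + k) = conjg f g + conjg f k"
  by (simp only: conjg_def group_simps)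

lemma conjg_uminus: "conjg f (- g) = - conjg f g"
  by (simp only: conjg_def group_simps)

lemma conjg_zero [simp]: "conjg 0 g = g" "conjg f 0 = 0"
  by (simp_all add: conjg_def)

lemma conjg_minus_cancel [simp]: "conjg (- f) (conjg f g) = g" "conjg f (conjg (- f) g) = g"
  by (simp_all flip: conjg_add)

lemma conjg_inject [simp]: "conjg f g = conjg f k \<longleftrightarrow> g = k"
  by (metis conjg_minus_cancel(1))

lemma conjg_eq_iff: "conjg f g = g \<longleftrightarrow> f + g = g + f"
  by (simp add: conjg_def diff_eq_eq)

lemma conjg_shift: "f + g = conjg f g + f"
  by (simp add: conjg_def)

lemma conjg_minus_fix: "conjg f g = g \<Longrightarrow> conjg (- f) g = g"
  by (metis conjg_minus_cancel(1))

locale aim_lc =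
  fixes act :: "'g::group_add \<Rightarrow> 'a \<Rightarrow> 'a" (infixr "\<cdot>" 75)
    and G :: "'g set" and Q :: "'a set" and e :: 'a and L R :: "'a \<Rightarrow> 'g"
  assumes act_add: "(f + g) \<cdot> x = f \<cdot> g \<cdot> x"
    and act_zero [simp]: "0 \<cdot> x = x"
    and faithful: "\<lbrakk>f \<in> G; g \<in> G; \<And>x. x \<in> Q \<Longrightarrow> f \<cdot> x = g \<cdot> x\<rbrakk> \<Longrightarrow> f = g"
    and G_add [simp]: "\<lbrakk>f \<in> G; g \<in> G\<rbrakk> \<Longrightarrow> f + g \<in> G"
    and G_uminus [simp]: "f \<in> G \<Longrightarrow> - f \<in> G"
    and G_Q [simp]: "\<lbrakk>f \<in> G; x \<in> Q\<rbrakk> \<Longrightarrow> f \<cdot> x \<in> Q"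
    and e_Q [simp]: "e \<in> Q"
    and L_G [simp]: "x \<in> Q \<Longrightarrow> L x \<in> G"
    and R_G [simp]: "x \<in> Q \<Longrightarrow> R x \<in> G"
    and L_R: "\<lbrakk>x \<in> Q; y \<in> Q\<rbrakk> \<Longrightarrow> L x \<cdot> y = R y \<cdot> x"
    and L_e [simp]: "x \<in> Q \<Longrightarrow> L x \<cdot> e = x"
    and R_e [simp]: "x \<in> Q \<Longrightarrow> R x \<cdot> e = x"
    and G_induct [consumes 1, case_names L R add uminus]:
      "\<lbrakk>g \<in> G; \<And>x. x \<in> Q \<Longrightarrow> P (L x); \<And>x. x \<in> Q \<Longrightarrow> P (R x);
        \<And>f g. \<lbrakk>f \<in> G; g \<in> G; P f; P g\<rbrakk> \<Longrightarrow> P (f + g); \<And>f. \<lbrakk>f \<in> G; P f\<rbrakk> \<Longrightarrow> P (- f)\<rbrakk> \<Longrightarrow> P g"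
    and aim: "\<lbrakk>f \<in> G; g \<in> G; f \<cdot> e = e; g \<cdot> e = e\<rbrakk> \<Longrightarrow> f + g = g + f"
    and L_square: "x \<in> Q \<Longrightarrow> L (L x \<cdot> x) = L x + L x"
    and L_square_R: "\<lbrakk>x \<in> Q; y \<in> Q\<rbrakk> \<Longrightarrow> L x + L x + R y = R y + L x + L x"
begin

lemma G_diff [simp]: "\<lbrakk>f \<in> G; g \<in> G\<rbrakk> \<Longrightarrow> f - g \<in> G"
  unfolding diff_conv_add_uminus by (rule G_add[OF _ G_uminus])

lemma G_zero [simp]: "0 \<in> G"
  using G_add[OF L_G G_uminus[OF L_G], OF e_Q e_Q] by simp

lemma G_conjg [simp]: "\<lbrakk>f \<in> G; g \<in> G\<rbrakk> \<Longrightarrow> conjg f g \<in> G"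
  by (simp add: conjg_def)

lemma act_minus [simp]: "- f \<cdot> f \<cdot> x = x" "f \<cdot> - f \<cdot> x = x"
  by (simp_all flip: act_add)

lemma act_diff: "(f - g) \<cdot> x = f \<cdot> - g \<cdot> x"
  by (simp only: diff_conv_add_uminus act_add)

lemma L_minus [simp]: "x \<in> Q \<Longrightarrow> - L x \<cdot> x = e"
  using act_minus(1)[of "L x" e] by simp

lemma R_minus [simp]: "x \<in> Q \<Longrightarrow> - R x \<cdot> x = e"
  using act_minus(1)[of "R x" e] by simp

definition H :: "'g set" where "H = {g \<in> G. g \<cdot> e = e}"

lemma H_mem: "\<lbrakk>g \<in> G; g \<cdot> e = e\<rbrakk> \<Longrightarrow> g \<in> H"
  by (simp add: H_def)

lemma H_add [simp]: "\<lbrakk>k \<in> H; l \<in> H\<rbrakk> \<Longrightarrow> k + l \<in> H"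
  by (simp add: H_def act_add)

lemma H_uminus [simp]: "k \<in> H \<Longrightarrow> - k \<in> H"
  using act_minus(1)[of k e] by (simp add: H_def)

lemma H_comm: "\<lbrakk>k \<in> H; l \<in> H\<rbrakk> \<Longrightarrow> k + l = l + k"
  unfolding H_def by (blast intro: aim)

lemma H_G [simp]: "k \<in> H \<Longrightarrow> k \<in> G"
  unfolding H_def by blast

lemma H_e [simp]: "k \<in> H \<Longrightarrow> k \<cdot> e = e"
  unfolding H_def by blast

lemma H_comm_act: "\<lbrakk>k \<in> H; l \<in> H\<rbrakk> \<Longrightarrow> k \<cdot> l \<cdot> x = l \<cdot> k \<cdot> x"
  using H_comm[of k l] by (simp flip: act_add)

lemma H_conjg: "\<lbrakk>k \<in> H; l \<in> H\<rbrakk> \<Longrightarrow> conjg k l = l"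
  by (simp add: conjg_eq_iff H_comm)

lemma H_I: "\<lbrakk>f \<in> G; g \<in> G; f \<cdot> e = g \<cdot> e\<rbrakk> \<Longrightarrow> - g + f \<in> H"
  by (rule H_mem) (simp_all add: act_add)

lemma conjg_H_cong:
  assumes "k \<in> H" "f \<in> G" "g \<in> G" "f \<cdot> e = g \<cdot> e"
  shows "conjg f k = conjg g k"
proof -
  have "conjg (- g) (conjg f k) = k"
    unfolding conjg_add[symmetric] by (rule H_conjg[OF H_I[OF assms(2-4)] assms(1)])
  from arg_cong[OF this, of "conjg g"] show ?thesis
    by simp
qed

text \<open>Since \<open>H\<close> is abelian, the conjugate of \<open>k \<in> H\<close> by \<open>g\<close> depends only on \<open>g \<cdot> e\<close>. Hence \<open>c k y\<close> is the
  conjugate of \<open>k\<close> by any \<open>g\<close> with \<open>g \<cdot> e = y\<close>, and \<open>G\<close> permutes these conjugates as it permutes \<open>Q\<close>.\<close>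

definition c :: "'g \<Rightarrow> 'a \<Rightarrow> 'g" where "c k y = conjg (L y) k"

lemma c_G [simp]: "\<lbrakk>k \<in> H; y \<in> Q\<rbrakk> \<Longrightarrow> c k y \<in> G"
  by (simp add: c_def)

lemma c_e [simp]: "k \<in> H \<Longrightarrow> c k e = k"
  unfolding c_def by (rule H_conjg[OF H_mem]) simp_all

lemma conjg_c: "\<lbrakk>g \<in> G; k \<in> H; y \<in> Q\<rbrakk> \<Longrightarrow> conjg g (c k y) = c k (g \<cdot> y)"
  unfolding c_def conjg_add[symmetric] by (rule conjg_H_cong) (simp_all add: act_add)

lemma conjg_H: "\<lbrakk>g \<in> G; k \<in> H\<rbrakk> \<Longrightarrow> conjg g k = c k (g \<cdot> e)"
  using conjg_c[of g k e] by simp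

definition t :: "'a \<Rightarrow> 'g" where "t y = - L y + R y"

lemma t_H [simp]: "y \<in> Q \<Longrightarrow> t y \<in> H"
  unfolding t_def by (rule H_I) simp_all

lemma R_eq: "R y = L y + t y"
  by (simp add: t_def flip: add.assoc)

lemma L_t: "\<lbrakk>x \<in> Q; y \<in> Q\<rbrakk> \<Longrightarrow> L y \<cdot> t y \<cdot> x = L x \<cdot> y"
  by (simp add: t_def act_add L_R)

text \<open>\<open>h a z\<close> fixes \<open>y\<close> iff \<open>a (y z) = (a y) z\<close>. The LC law enters only through
  the fact that \<open>L a\<close> conjugates \<open>h a z\<close> to its negative, and through left inverses.\<close>

definition h :: "'a \<Rightarrow> 'a \<Rightarrow> 'g" where "h a z = - L a + - R z + L a + R z"

lemma h_H [simp]: "\<lbrakk>a \<in> Q; z \<in> Q\<rbrakk> \<Longrightarrow> h a z \<in> H"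
  by (rule H_mem) (simp_all add: h_def act_add act_diff L_R)

lemma h_act: "h a z \<cdot> x = - L a \<cdot> - R z \<cdot> L a \<cdot> R z \<cdot> x"
  by (simp add: h_def act_add act_diff)

lemma c_h_self:
  assumes "x \<in> Q" "z \<in> Q" shows "c (h x z) x = - h x z"
proof -
  have *: "L x + L x + R z = R z + L x + L x" using assms by (rule L_square_R)
  have "c (h x z) x = - R z + L x + R z + - L x"
    by (simp only: c_def conjg_def h_def group_simps)
  also have "L x + R z + - L x = - L x + R z + L x"
  proof -
    have "L x + (L x + R z + - L x) = L x + (- L x + R z + L x)"
      using arg_cong[OF *, of "\<lambda>g. g + - L x"] by (simp only: group_simps)
    then show ?thesis by (rule add_left_imp_eq)
  qed
  then have "- R z + L x + R z + - L x = - R z + (- L x + R z + L x)"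
    by (simp only: add.assoc)
  also have "\<dots> = - h x z"
    by (simp only: h_def group_simps)
  finally show ?thesis .
qed

lemma c_h_H: "\<lbrakk>x \<in> Q; z \<in> Q; k \<in> H\<rbrakk> \<Longrightarrow> c (h x z) (k \<cdot> x) = - h x z"
  using conjg_c[of k "h x z" x] by (simp add: c_h_self conjg_uminus H_conjg)

lemma conjg_L_c_h:
  assumes "x \<in> Q" "z \<in> Q" "y \<in> Q" shows "conjg (L x) (c (h x z) y) = - c (h x z) y"
proof -
  have "conjg (L x) (c (h x z) y) = conjg (L y) (c (h x z) (t y \<cdot> x))"
    using assms by (simp add: conjg_c L_t)
  then show ?thesis
    using assms by (simp add: c_h_H conjg_uminus) (simp add: c_def)
qed

lemma conjg_R_c_h:
  assumes "x \<in> Q" "z \<in> Q" "y \<in> Q" shows "conjg (R x) (c (h x z) y) = - c (h x z) y"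
proof -
  have "conjg (R x) (c (h x z) y) = conjg (L y) (c (h x z) x)"
    using assms by (simp add: conjg_c flip: L_R)
  then show ?thesis
    using assms by (simp add: c_h_self conjg_uminus) (simp add: c_def)
qed

definition perp :: "'a \<Rightarrow> 'a \<Rightarrow> bool" where
  "perp x p \<longleftrightarrow> x \<in> Q \<and> p \<in> Q \<and> (\<forall>z\<in>Q. c (h x z) p = h x z)"

lemma perp_Q: assumes "perp x p" shows "x \<in> Q" "p \<in> Q"
  using assms by (simp_all add: perp_def)

lemma perp_conjg: "\<lbrakk>perp x p; z \<in> Q; g \<in> G; g \<cdot> e = p\<rbrakk> \<Longrightarrow> conjg g (h x z) = h x z"
  by (simp add: perp_def conjg_H)

lemma perp_H: "\<lbrakk>perp x p; k \<in> H\<rbrakk> \<Longrightarrow> perp x (k \<cdot> p)"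
  unfolding perp_def by (auto simp: H_conjg simp flip: conjg_c)

text \<open>The stabiliser of all \<open>h x z\<close> is a subgroup of \<open>G\<close> containing \<open>H\<close>, which makes
  \<open>{p. perp x p}\<close> a normal subloop.\<close>

definition C :: "'a \<Rightarrow> 'g set" where "C x = {g \<in> G. perp x (g \<cdot> e)}"

lemma C_iff: "x \<in> Q \<Longrightarrow> g \<in> C x \<longleftrightarrow> g \<in> G \<and> (\<forall>z\<in>Q. conjg g (h x z) = h x z)"
  by (auto simp: C_def perp_def conjg_H)

lemma C_add: "\<lbrakk>x \<in> Q; f \<in> C x; g \<in> C x\<rbrakk> \<Longrightarrow> f + g \<in> C x"
  by (simp add: C_iff conjg_add)

lemma C_uminus: "\<lbrakk>x \<in> Q; f \<in> C x\<rbrakk> \<Longrightarrow> - f \<in> C x"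
  by (simp add: C_iff conjg_minus_fix)

lemma H_C: "\<lbrakk>x \<in> Q; k \<in> H\<rbrakk> \<Longrightarrow> k \<in> C x"
  by (simp add: C_iff H_conjg)

lemma perp_L_C: "perp x p \<Longrightarrow> L p \<in> C x"
  by (simp add: C_def perp_def)

lemma perp_R_C: "perp x p \<Longrightarrow> R p \<in> C x"
  by (simp add: C_def perp_def)

lemma perp_commute_h: "\<lbrakk>perp x p; z \<in> Q\<rbrakk> \<Longrightarrow> h x z + L p = L p + h x z"
  using perp_conjg[of x p z "L p"] by (simp add: perp_Q conjg_eq_iff)

lemma perp_L_mult:
  assumes "perp x p" shows "L (L x \<cdot> p) = L x + L p"
proof (rule faithful)
  fix y assume y: "y \<in> Q"
  have q: "x \<in> Q" "p \<in> Q" using assms perp_Q by auto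
  have "h x y \<cdot> p = p"
    using perp_commute_h[OF assms y] q y by (metis H_e L_e act_add h_H)
  then have "L x \<cdot> R y \<cdot> p = R y \<cdot> L x \<cdot> p"
    unfolding h_act by (metis act_minus(2))
  then show "L (L x \<cdot> p) \<cdot> y = (L x + L p) \<cdot> y"
    using q y by (simp add: act_add L_R)
qed (use assms perp_Q in auto)

lemma h_perp_mult:
  assumes "perp x p" "z \<in> Q" shows "h (L x \<cdot> p) z = h x z + h p z"
proof -
  have "h (L x \<cdot> p) z = - L p + h x z + L p + h p z"
    by (simp only: h_def perp_L_mult[OF assms(1)] group_simps)
  also have "- L p + h x z + L p = h x z"
    using perp_commute_h[OF assms] by (metis add.assoc minus_add_cancel)
  finally show ?thesis .
qed

lemma perp_sym:
  assumes "perp x p" shows "perp p x"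
  unfolding perp_def
proof (intro conjI ballI)
  show q: "p \<in> Q" "x \<in> Q" using assms perp_Q by auto
  fix z assume z: "z \<in> Q"
  have "conjg (L x + L p) (h x z + h p z) = - (h x z + h p z)"
    using c_h_self[of "L x \<cdot> p" z] assms q z by (simp add: c_def perp_L_mult h_perp_mult)
  moreover have "conjg (L x + L p) (h x z + h p z) = - h x z + - conjg (L x) (h p z)"
    using c_h_self[of x z] c_h_self[of p z] perp_conjg[OF assms z, of "L p"] q z
    by (simp add: conjg_add conjg_plus c_def conjg_uminus)
  moreover have "- (h x z + h p z) = - h x z + - h p z"
    by (metis H_comm h_H minus_add q z)
  ultimately have "- h x z + - conjg (L x) (h p z) = - h x z + - h p z"
    by (simp only:)
  then show "c (h p z) x = h p z"
    by (simp only: add_left_cancel neg_equal_iff_equal c_def)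
qed

lemma perp_self_H:
  assumes "x \<in> Q" "k \<in> H" shows "perp x (- L x \<cdot> k \<cdot> x)"
  unfolding perp_def
proof (intro conjI ballI)
  fix z assume z: "z \<in> Q"
  have "c (h x z) (- L x \<cdot> k \<cdot> x) = conjg (- L x) (c (h x z) (k \<cdot> x))"
    using assms z by (simp add: conjg_c)
  also have "\<dots> = conjg (- L x) (c (h x z) x)"
    using assms z by (simp add: c_h_H c_h_self)
  finally show "c (h x z) (- L x \<cdot> k \<cdot> x) = h x z"
    by (simp add: c_def)
qed (use assms in auto)

lemma perp_mult: "\<lbrakk>perp x p; perp x q\<rbrakk> \<Longrightarrow> perp x (L p \<cdot> q)"
proof -
  assume a: "perp x p" "perp x q"
  then have "L p + L q \<in> C x"
    by (simp add: C_add perp_L_C perp_Q)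
  then show ?thesis
    using a by (simp add: C_def act_add perp_Q)
qed

definition N :: "'a \<Rightarrow> 'g set" where
  "N x = {g \<in> G. \<forall>y\<in>Q. \<forall>z\<in>Q. c (h x z) (g \<cdot> y) = c (h x z) y}"

lemma N_G: "g \<in> N x \<Longrightarrow> g \<in> G"
  by (simp add: N_def)

lemma N_iff: "x \<in> Q \<Longrightarrow> g \<in> N x \<longleftrightarrow> g \<in> G \<and> (\<forall>y\<in>Q. \<forall>z\<in>Q. conjg g (c (h x z) y) = c (h x z) y)"
  by (auto simp: N_def conjg_c)

lemma N_add: "\<lbrakk>x \<in> Q; f \<in> N x; g \<in> N x\<rbrakk> \<Longrightarrow> f + g \<in> N x"
  by (simp add: N_iff conjg_add)

lemma N_uminus: "\<lbrakk>x \<in> Q; f \<in> N x\<rbrakk> \<Longrightarrow> - f \<in> N x"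
  by (simp add: N_iff conjg_minus_fix)

lemma N_conjg:
  assumes "x \<in> Q" "f \<in> G" "g \<in> N x" shows "conjg f g \<in> N x"
proof -
  have "conjg (conjg f g) (c (h x z) y) = c (h x z) y" if "y \<in> Q" "z \<in> Q" for y z
  proof -
    have "conjg (conjg f g) (c (h x z) y) = conjg f (conjg g (c (h x z) (- f \<cdot> y)))"
      unfolding conjg_def[of f g] diff_conv_add_uminus conjg_add using assms that N_G[of g x] by (simp add: conjg_c)
    also have "\<dots> = c (h x z) y"
      using assms that by (simp add: N_iff) (simp add: conjg_c)
    finally show ?thesis .
  qed
  with assms show ?thesis
    by (simp add: N_iff)
qed

text \<open>\<open>L x\<close> and \<open>R x\<close> act as negation on all conjugates of \<open>h x z\<close>, so they are central modulo \<open>N x\<close>.\<close>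

lemma N_commutator:
  assumes "x \<in> Q" "g \<in> G" "f \<in> {L x, R x}"
  shows "- f + - g + f + g \<in> N x" "- g + - f + g + f \<in> N x"
proof -
  have f: "f \<in> G" using assms by auto
  have neg: "conjg f (c (h x z) y) = - c (h x z) y" if "y \<in> Q" "z \<in> Q" for y z
    using assms that by (auto simp: conjg_L_c_h conjg_R_c_h)
  have neg': "conjg (- f) (c (h x z) y) = - c (h x z) y" if "y \<in> Q" "z \<in> Q" for y z
    by (metis neg[OF that] conjg_minus_cancel(1) conjg_uminus minus_minus)
  have "conjg (- f + - g + f + g) (c (h x z) y) = c (h x z) y"
    "conjg (- g + - f + g + f) (c (h x z) y) = c (h x z) y" if "y \<in> Q" "z \<in> Q" for y z
    using that assms f by (simp_all add: conjg_add conjg_diff conjg_c[of g] conjg_c[of "- g"] conjg_uminus neg neg')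
  then show "- f + - g + f + g \<in> N x" "- g + - f + g + f \<in> N x"
    using assms f by (simp_all add: N_iff)
qed

lemma h_N: assumes "x \<in> Q" "z \<in> Q" shows "h x z \<in> N x" "h z x \<in> N x"
  using N_commutator[of x "R z" "L x"] N_commutator[of x "L z" "R x"] assms by (simp_all add: h_def)

lemma t_N:
  assumes "x \<in> Q" shows "t x \<in> N x"
proof -
  have "conjg (- L x) (c (h x z) y) = - c (h x z) y" if "y \<in> Q" "z \<in> Q" for y z
    by (metis conjg_L_c_h[OF assms(1) that(2,1)] conjg_minus_cancel(1) conjg_uminus minus_minus)
  with assms show ?thesis
    by (simp add: N_iff t_def conjg_add conjg_R_c_h conjg_uminus)
qed

lemma N_C: "\<lbrakk>x \<in> Q; g \<in> N x\<rbrakk> \<Longrightarrow> g \<in> C x"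
  using c_e h_H e_Q by (auto simp: N_def C_def perp_def)

lemma N_I:
  assumes "x \<in> Q" "g \<in> G" "\<And>y. y \<in> Q \<Longrightarrow> perp x (- L y \<cdot> g \<cdot> y)" shows "g \<in> N x"
proof -
  have "c (h x z) (g \<cdot> y) = c (h x z) y" if "y \<in> Q" "z \<in> Q" for y z
  proof -
    have "conjg (- L y) (c (h x z) (g \<cdot> y)) = h x z"
      using assms that by (simp add: conjg_c) (simp add: perp_def)
    then show ?thesis
      unfolding c_def by (metis conjg_minus_cancel(2))
  qed
  then show ?thesis using assms by (simp add: N_def)
qed

lemma perp_L_N:
  assumes "perp x p" shows "L p \<in> N x"
proof (rule N_I)
  fix y assume y: "y \<in> Q"
  have "perp x (t y \<cdot> p)" using assms y by (simp add: perp_H)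
  then show "perp x (- L y \<cdot> L p \<cdot> y)"
    using assms y by (simp add: t_def act_add L_R perp_Q)
qed (use assms perp_Q in auto)

lemma L_unit [simp]: "x \<in> Q \<Longrightarrow> L e \<cdot> x = x"
  by (simp add: L_R)

lemma R_unit [simp]: "x \<in> Q \<Longrightarrow> R e \<cdot> x = x"
  by (simp flip: L_R)

subsection \<open>The left nucleus and the modules \<open>E x\<close>\<close>

definition M :: "'a set" where "M = {a \<in> Q. \<forall>z\<in>Q. h a z = 0}"

lemma M_mem: "\<lbrakk>a \<in> Q; \<And>z. z \<in> Q \<Longrightarrow> h a z = 0\<rbrakk> \<Longrightarrow> a \<in> M"
  by (simp add: M_def)

lemma M_h: "\<lbrakk>a \<in> M; z \<in> Q\<rbrakk> \<Longrightarrow> h a z = 0"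
  by (simp add: M_def)

lemma M_Q [simp]: "a \<in> M \<Longrightarrow> a \<in> Q"
  unfolding M_def by blast

lemma h_zero_iff: "h a z = 0 \<longleftrightarrow> L a + R z = R z + L a"
proof -
  have "h a z = - (R z + L a) + (L a + R z)"
    by (simp only: h_def group_simps)
  then show ?thesis
    by (metis add_minus_cancel left_minus add_0_right)
qed

lemma M_L_R: "\<lbrakk>a \<in> M; z \<in> Q\<rbrakk> \<Longrightarrow> L a + R z = R z + L a"
  by (simp add: M_h flip: h_zero_iff)

lemma M_perp: "\<lbrakk>a \<in> M; x \<in> Q\<rbrakk> \<Longrightarrow> perp x a"
  by (rule perp_sym) (simp add: perp_def M_h c_def)

lemma M_I:
  assumes "p \<in> Q" "\<And>x. x \<in> Q \<Longrightarrow> perp x p" shows "p \<in> M"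
proof -
  have "h p z = 0" if z: "z \<in> Q" for z
  proof (rule faithful)
    fix x assume x: "x \<in> Q"
    have "h p z + L x = L x + h p z"
      by (rule perp_commute_h[OF perp_sym[OF assms(2)[OF x]] z])
    then have "h p z \<cdot> L x \<cdot> e = L x \<cdot> h p z \<cdot> e"
      by (metis act_add)
    then show "h p z \<cdot> x = 0 \<cdot> x"
      using x z assms(1) by simp
  qed (use assms z in auto)
  with assms(1) show ?thesis by (rule M_mem)
qed

lemma M_H: "\<lbrakk>a \<in> M; k \<in> H\<rbrakk> \<Longrightarrow> k \<cdot> a \<in> M"
  by (rule M_I) (auto intro: perp_H M_perp)

lemma e_M [simp]: "e \<in> M"
  by (rule M_I) (simp_all add: perp_def)

lemma perp_inverse: "perp x p \<Longrightarrow> perp x (- L p \<cdot> e)"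
  using C_uminus[of x "L p"] perp_L_C[of x p] perp_Q[of x p] by (simp add: C_def)

lemma M_mult: "\<lbrakk>a \<in> M; b \<in> M\<rbrakk> \<Longrightarrow> L a \<cdot> b \<in> M"
  by (rule M_I) (auto intro: perp_mult M_perp)

lemma M_inverse: "a \<in> M \<Longrightarrow> - L a \<cdot> e \<in> M"
  by (rule M_I) (auto intro: perp_inverse M_perp)

lemma square_M: "x \<in> Q \<Longrightarrow> L x \<cdot> x \<in> M"
  using L_square_R[of x] by (intro M_mem) (simp_all add: h_zero_iff L_square add.assoc)

lemma L_M_left: "\<lbrakk>a \<in> M; x \<in> Q\<rbrakk> \<Longrightarrow> L (L a \<cdot> x) = L a + L x"
  by (rule perp_L_mult, rule perp_sym, rule M_perp)

lemma L_M_right: "\<lbrakk>a \<in> M; x \<in> Q\<rbrakk> \<Longrightarrow> L (L x \<cdot> a) = L x + L a"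
  by (rule perp_L_mult, rule M_perp)

lemma L_inverse:
  assumes "x \<in> Q" shows "L (- L x \<cdot> e) = - L x"
proof (rule faithful)
  fix y assume y: "y \<in> Q"
  let ?x = "- L x \<cdot> e"
  have "L x \<cdot> L x \<cdot> L ?x \<cdot> y = (L x + L x + R y) \<cdot> ?x"
    using assms y by (simp add: act_add L_R)
  also have "\<dots> = L x \<cdot> y"
    unfolding L_square_R[OF assms y] using assms y by (simp add: act_add L_R)
  finally show "L ?x \<cdot> y = - L x \<cdot> y"
    by (metis act_minus(1))
qed (use assms in auto)

definition sim :: "'a \<Rightarrow> 'a \<Rightarrow> bool" (infix "\<approx>" 50) where
  "u \<approx> v \<longleftrightarrow> u \<in> Q \<and> v \<in> Q \<and> (\<exists>b\<in>M. u = L b \<cdot> v)"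

lemma sim_I: "\<lbrakk>b \<in> M; v \<in> Q\<rbrakk> \<Longrightarrow> L b \<cdot> v \<approx> v"
  by (auto simp: sim_def)

lemma sim_sym: assumes "u \<approx> v" shows "v \<approx> u"
proof -
  from assms obtain b where "b \<in> M" "u = L b \<cdot> v" "u \<in> Q" "v \<in> Q" by (auto simp: sim_def)
  then show ?thesis
    using sim_I[of "- L b \<cdot> e" u] by (simp add: L_inverse M_inverse)
qed

lemma sim_trans [trans]: assumes "u \<approx> v" "v \<approx> w" shows "u \<approx> w"
proof -
  from assms obtain a b where "a \<in> M" "u = L a \<cdot> v" "b \<in> M" "v = L b \<cdot> w" "w \<in> Q"
    by (auto simp: sim_def)
  then show ?thesis
    using sim_I[of "L a \<cdot> b" w] by (simp add: L_M_left M_mult act_add)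
qed

lemma L_M_swap:
  assumes "b \<in> M" "x \<in> Q" obtains b' where "b' \<in> M" "L x + L b = L b' + L x"
proof
  let ?b = "- t x \<cdot> b"
  show b': "?b \<in> M" using assms by (simp add: M_H)
  have "L ?b \<cdot> x = L x \<cdot> b"
    unfolding L_R[OF M_Q[OF b'] assms(2)] by (simp add: R_eq act_add)
  then show "L x + L b = L ?b + L x"
    using assms b' by (metis L_M_left L_M_right)
qed

lemma sim_L: assumes "u \<approx> v" "x \<in> Q" shows "L x \<cdot> u \<approx> L x \<cdot> v"
proof -
  from assms obtain b where b: "b \<in> M" "u = L b \<cdot> v" "v \<in> Q" by (auto simp: sim_def)
  obtain b' where "b' \<in> M" "L x + L b = L b' + L x" using L_M_swap b assms(2) by blast
  then show ?thesis
    using b assms(2) sim_I[of b' "L x \<cdot> v"] by (metis G_Q L_G act_add)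
qed

lemma sim_R: assumes "u \<approx> v" "x \<in> Q" shows "R x \<cdot> u \<approx> R x \<cdot> v"
proof -
  from assms obtain b where b: "b \<in> M" "u = L b \<cdot> v" "v \<in> Q" by (auto simp: sim_def)
  then show ?thesis
    using sim_I[of b "R x \<cdot> v"] M_L_R[OF b(1) assms(2)] assms(2) by (metis G_Q R_G act_add)
qed

lemma sim_L_minus: assumes "u \<approx> v" "x \<in> Q" shows "- L x \<cdot> u \<approx> - L x \<cdot> v"
  using sim_L[OF assms(1), of "- L x \<cdot> e"] assms(2) by (simp add: L_inverse)

lemma sim_LL: "\<lbrakk>x \<in> Q; u \<in> Q\<rbrakk> \<Longrightarrow> L x \<cdot> L x \<cdot> u \<approx> u"
  using sim_I[OF square_M, of x u] by (simp add: L_square act_add)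

lemma sim_square: assumes "x \<in> Q" "u \<in> Q" shows "L u \<cdot> L x \<cdot> x \<approx> u"
  using sim_L[OF sim_I[OF square_M e_Q], of x u] assms by simp

definition E :: "'a \<Rightarrow> 'g set" where
  "E x = {g \<in> N x. (\<forall>n\<in>N x. conjg n g = g) \<and> conjg (L x) g = - g}"

lemma E_N: "g \<in> E x \<Longrightarrow> g \<in> N x"
  by (simp add: E_def)

lemma E_G: "g \<in> E x \<Longrightarrow> g \<in> G"
  by (blast intro: E_N N_G)

lemma E_fix: "\<lbrakk>g \<in> E x; n \<in> N x\<rbrakk> \<Longrightarrow> conjg n g = g"
  by (simp add: E_def)

lemma E_L: "g \<in> E x \<Longrightarrow> conjg (L x) g = - g"
  by (simp add: E_def)

lemma E_uminus: "\<lbrakk>x \<in> Q; g \<in> E x\<rbrakk> \<Longrightarrow> - g \<in> E x"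
  by (simp add: E_def N_uminus conjg_uminus)

lemma E_add: 
  assumes "x \<in> Q" "f \<in> E x" "g \<in> E x" shows "f + g \<in> E x"
proof -
  have "f + g = g + f"
    using E_fix[OF assms(3) E_N[OF assms(2)]] by (simp add: conjg_eq_iff)
  then have "conjg (L x) (f + g) = - (f + g)"
    using assms by (metis E_L conjg_plus minus_add)
  with assms show ?thesis
    by (simp add: E_def N_add conjg_plus)
qed

lemma E_h: "\<lbrakk>x \<in> Q; z \<in> Q\<rbrakk> \<Longrightarrow> h x z \<in> E x"
  using c_h_self[of x z] N_C[of x] by (simp add: E_def h_N C_iff c_def)

lemma E_conjg:
  assumes "x \<in> Q" "f \<in> G" "g \<in> E x" shows "conjg f g \<in> E x"
proof -
  have *: "conjg n (conjg f g) = conjg f (conjg (conjg (- f) n) g)" for n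
    by (simp add: conjg_def[of "- f" n] conjg_add)
  have "conjg n (conjg f g) = conjg f g" if "n \<in> N x" for n
    unfolding * using assms that by (simp add: E_fix N_conjg)
  moreover have "conjg (L x) (conjg f g) = - conjg f g"
  proof -
    let ?n = "- L x + - f + L x + f"
    have "L x + f = f + L x + ?n"
      by (simp only: group_simps)
    then have "conjg (L x) (conjg f g) = conjg f (conjg (L x) (conjg ?n g))"
      by (metis conjg_add)
    also have "\<dots> = - conjg f g"
      using assms N_commutator(1)[of x f "L x"] by (simp add: E_fix E_L conjg_uminus)
    finally show ?thesis .
  qed
  ultimately show ?thesis
    using assms by (simp add: E_def N_conjg)
qed

text \<open>By \<open>lassoc_assoc\<close> below, \<open>lassoc a y z\<close> is the associator defined by
  \<open>a (y z) = lassoc a y z ((a y) z)\<close>.\<close>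

definition lassoc :: "'a \<Rightarrow> 'a \<Rightarrow> 'a \<Rightarrow> 'a" where
  "lassoc a y z = - R y \<cdot> h a z \<cdot> y"

lemma lassoc_Q [simp]: "\<lbrakk>a \<in> Q; y \<in> Q; z \<in> Q\<rbrakk> \<Longrightarrow> lassoc a y z \<in> Q"
  by (simp add: lassoc_def)

lemma lassoc_conj: "y \<in> Q \<Longrightarrow> conjg (- R y) (h a z) \<cdot> e = lassoc a y z"
  by (simp add: lassoc_def conjg_def act_add)

lemma E_lassoc: "\<lbrakk>a \<in> Q; y \<in> Q; z \<in> Q\<rbrakk> \<Longrightarrow> conjg (- R y) (h a z) \<in> E a"
  by (simp add: E_conjg E_h)

lemma L_lassoc: "\<lbrakk>a \<in> Q; y \<in> Q; z \<in> Q\<rbrakk> \<Longrightarrow> L (lassoc a y z) \<cdot> y = h a z \<cdot> y"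
  by (simp add: L_R) (simp add: lassoc_def)

lemma perp_N: "\<lbrakk>x \<in> Q; g \<in> N x\<rbrakk> \<Longrightarrow> perp x (g \<cdot> e)"
  using N_C[of x g] by (simp add: C_def)

lemma perp_lassoc:
  assumes "a \<in> Q" "y \<in> Q" "z \<in> Q"
  shows "perp a (lassoc a y z)" "perp y (lassoc a y z)" "perp z (lassoc a y z)"
proof -
  show "perp a (lassoc a y z)" "perp z (lassoc a y z)"
    using assms perp_N N_conjg[of _ "- R y" "h a z"] h_N by (metis G_uminus R_G lassoc_conj)+
  have "- R y = - t y + - L y"
    by (simp only: R_eq minus_add)
  then have "lassoc a y z = - t y \<cdot> - L y \<cdot> h a z \<cdot> y"
    by (simp only: lassoc_def act_add)
  then show "perp y (lassoc a y z)"
    using perp_H[OF perp_self_H[OF assms(2) h_H[OF assms(1,3)]], of "- t y"] assms by simp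
qed

lemma perp_L_commute:
  assumes "perp x p" "L x \<cdot> p = L p \<cdot> x" shows "L x + L p = L p + L x"
  using perp_L_mult[OF assms(1)] perp_L_mult[OF perp_sym[OF assms(1)]] assms(2) by simp

lemma lassoc_H_N:
  assumes "a \<in> Q" "y \<in> Q" "z \<in> Q" "k \<in> H" "k \<in> N a"
  shows "k + L (lassoc a y z) = L (lassoc a y z) + k" "k \<cdot> lassoc a y z = lassoc a y z"
proof -
  let ?n = "conjg (- R y) (h a z)"
  let ?k = "- L (lassoc a y z) + ?n"
  have n: "?n \<in> E a" using assms by (simp add: E_lassoc)
  have "?k \<in> H"
    using assms n E_G by (intro H_I) (simp_all add: lassoc_conj)
  then have "conjg k ?k = ?k" using assms by (simp only: H_conjg)
  moreover have "conjg k ?n = ?n" using n assms by (simp only: E_fix)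
  moreover have "conjg k (?n + - ?k) = conjg k ?n + - conjg k ?k"
    by (simp only: conjg_plus conjg_uminus)
  ultimately have "conjg k (?n + - ?k) = ?n + - ?k"
    by (simp only:)
  moreover have "?n + - ?k = L (lassoc a y z)"
    by (simp only: group_simps)
  ultimately have *: "conjg k (L (lassoc a y z)) = L (lassoc a y z)" by simp
  then show "k + L (lassoc a y z) = L (lassoc a y z) + k" by (simp add: conjg_eq_iff)
  then show "k \<cdot> lassoc a y z = lassoc a y z"
    using assms by (metis H_e L_e act_add lassoc_Q)
qed

lemma lassoc_L_commute:
  assumes "a \<in> Q" "y \<in> Q" "z \<in> Q"
  shows "L a + L (lassoc a y z) = L (lassoc a y z) + L a"
proof (rule perp_L_commute)
  show "L a \<cdot> lassoc a y z = L (lassoc a y z) \<cdot> a"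
    using lassoc_H_N(2)[OF assms, of "t a"] L_t[of "lassoc a y z" a] assms by (simp add: t_N)
qed (use assms perp_lassoc in auto)

lemma lassoc_assoc:
  assumes "a \<in> Q" "y \<in> Q" "z \<in> Q"
  shows "L a \<cdot> L y \<cdot> z = L (lassoc a y z) \<cdot> L (L a \<cdot> y) \<cdot> z"
proof -
  let ?p = "lassoc a y z"
  have "- L a \<cdot> - R z \<cdot> L a \<cdot> R z \<cdot> y = L ?p \<cdot> y"
    using assms by (simp add: L_lassoc h_act)
  then have "L a \<cdot> R z \<cdot> y = R z \<cdot> L a \<cdot> L ?p \<cdot> y"
    by (metis act_minus(2))
  also have "L a \<cdot> L ?p \<cdot> y = L ?p \<cdot> L a \<cdot> y"
    using lassoc_L_commute[OF assms] by (metis act_add)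
  also have "R z \<cdot> L ?p \<cdot> L a \<cdot> y = L (L ?p \<cdot> L a \<cdot> y) \<cdot> z"
    using assms by (simp add: L_R)
  also have "perp ?p (L a \<cdot> y)"
    using assms by (intro perp_mult perp_sym[OF perp_lassoc(1)] perp_sym[OF perp_lassoc(2)])
  then have "L (L ?p \<cdot> L a \<cdot> y) = L ?p + L (L a \<cdot> y)"
    by (rule perp_L_mult)
  finally show ?thesis
    using assms by (simp add: L_R act_add)
qed

definition inner_R :: "'a \<Rightarrow> 'a \<Rightarrow> 'g" where
  "inner_R y z = - R (L y \<cdot> z) + (R z + R y)"

lemma inner_R_H [simp]: "\<lbrakk>y \<in> Q; z \<in> Q\<rbrakk> \<Longrightarrow> inner_R y z \<in> H"
  unfolding inner_R_def by (rule H_I) (simp_all add: act_add L_R)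

lemma commute_uminus: "f + g = g + f \<Longrightarrow> f + - g = - g + f" for f g :: 'g
  by (simp only: conjg_uminus flip: conjg_eq_iff)

lemma L_minus_lassoc:
  assumes "a \<in> Q" "y \<in> Q" "z \<in> Q"
  shows "L (- L (lassoc a y z) \<cdot> a) = L a + - L (lassoc a y z)"
proof -
  let ?p = "lassoc a y z"
  have "- L ?p + L a = L a + - L ?p"
    using commute_uminus[OF lassoc_L_commute[OF assms]] by (simp only:)
  then have "- L ?p \<cdot> L a \<cdot> e = L a \<cdot> - L ?p \<cdot> e"
    by (metis act_add)
  moreover have "perp a (- L ?p \<cdot> e)"
    using assms by (intro perp_inverse perp_lassoc)
  ultimately show ?thesis
    using assms by (simp add: perp_L_mult L_inverse)
qed

lemma inner_R_act:
  assumes "a \<in> Q" "y \<in> Q" "z \<in> Q"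
  shows "inner_R y z \<cdot> a = - L (lassoc a y z) \<cdot> a"
proof -
  let ?p = "lassoc a y z"
  have "R (L y \<cdot> z) \<cdot> - L ?p \<cdot> a = L (- L ?p \<cdot> a) \<cdot> L y \<cdot> z"
    using assms by (intro L_R[symmetric]) simp_all
  also have "\<dots> = - L ?p \<cdot> L a \<cdot> L y \<cdot> z"
    unfolding L_minus_lassoc[OF assms] commute_uminus[OF lassoc_L_commute[OF assms]] act_add ..
  also have "\<dots> = R z \<cdot> R y \<cdot> a"
    unfolding lassoc_assoc[OF assms] act_minus using assms by (simp add: L_R)
  finally have "- L ?p \<cdot> a = - R (L y \<cdot> z) \<cdot> R z \<cdot> R y \<cdot> a"
    by (metis act_minus(1))
  then show ?thesis
    by (simp add: inner_R_def act_add)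
qed

text \<open>If \<open>k\<close> acts trivially modulo \<open>{p. perp a p}\<close>, it commutes with left multiplication by every
  associator \<open>lassoc a y z\<close>. Applying \<open>k\<close> to \<open>inner_R_act\<close> then shows that \<open>a\<close> and \<open>k \<cdot> a\<close> have
  the same associators, so they differ by an element of the left nucleus \<open>M\<close>.\<close>

lemma H_N_self:
  assumes a: "a \<in> Q" and k: "k \<in> H" "k \<in> N a"
  obtains b where "b \<in> M" "L (k \<cdot> a) = L b + L a"
proof
  let ?a = "k \<cdot> a"
  let ?f = "L ?a + - L a"
  have h_eq: "h ?a z = h a z" if z: "z \<in> Q" for z
  proof (rule faithful)
    fix y assume y: "y \<in> Q"
    let ?u = "inner_R y z \<cdot> ?a"
    have "?u = k \<cdot> - L (lassoc a y z) \<cdot> a"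
      using H_comm_act[of "inner_R y z" k a] a k y z by (simp add: inner_R_act)
    then have "L (lassoc a y z) \<cdot> ?u = ?a"
      using lassoc_H_N(1)[OF a y z k] by (metis act_add act_minus(2))
    moreover have "L (lassoc ?a y z) \<cdot> ?u = ?a"
      using a k y z by (simp add: inner_R_act)
    ultimately have "R ?u \<cdot> lassoc ?a y z = R ?u \<cdot> lassoc a y z"
      using a k y z by (simp add: L_R)
    then have "lassoc ?a y z = lassoc a y z"
      by (metis act_minus(1))
    then show "h ?a z \<cdot> y = h a z \<cdot> y"
      using a k y z by (simp flip: L_lassoc)
  qed (use a k z in auto)
  have comm: "?f + R z = R z + ?f" if z: "z \<in> Q" for z
  proof -
    have "- L ?a + - R z + L ?a + R z = - L a + - R z + L a + R z"
      using h_eq[OF z] by (simp only: h_def)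
    then have "L ?a + ((- L ?a + - R z + L ?a) + - L a) = L ?a + ((- L a + - R z + L a) + - L a)"
      by simp
    then have "- R z + ?f = ?f + - R z"
      by (simp only: group_simps)
    then have "R z + (- R z + ?f) + R z = R z + (?f + - R z) + R z" by simp
    then show ?thesis by (simp only: group_simps)
  qed
  have f: "?f = L (?f \<cdot> e)"
  proof (rule faithful)
    fix z assume z: "z \<in> Q"
    have "?f \<cdot> z = ?f \<cdot> R z \<cdot> e" using z by simp
    also have "\<dots> = R z \<cdot> ?f \<cdot> e" using comm[OF z] by (metis act_add)
    finally show "?f \<cdot> z = L (?f \<cdot> e) \<cdot> z" using a k z by (simp add: L_R)
  qed (use a k in auto)
  show "?f \<cdot> e \<in> M"
  proof (rule M_mem)
    show "h (?f \<cdot> e) z = 0" if "z \<in> Q" for z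
      unfolding h_zero_iff f[symmetric] using that by (rule comm)
  qed (use a k in simp)
  show "L ?a = L (?f \<cdot> e) + L a"
    unfolding f[symmetric] by (simp only: group_simps)
qed

lemma sim_RR:
  assumes "a \<in> Q" "x \<in> Q" shows "R a \<cdot> R a \<cdot> x \<approx> x"
proof -
  obtain b where b: "b \<in> M" "L (h x a \<cdot> a) = L b + L a"
    using assms H_N_self[of a "h x a"] h_N by auto
  have "h x a \<cdot> a = (L b + L a) \<cdot> e"
    using b(2) assms by (metis G_Q H_G L_e h_H)
  then have "h x a \<cdot> a = R a \<cdot> b"
    using assms b by (simp add: act_add L_R)
  then have "lassoc x a a = b"
    by (simp add: lassoc_def)
  then have "L x \<cdot> L a \<cdot> a = L b \<cdot> R a \<cdot> R a \<cdot> x"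
    using lassoc_assoc[of x a a] assms by (simp add: L_R)
  then have "L x \<cdot> L a \<cdot> a \<approx> R a \<cdot> R a \<cdot> x"
    using assms b sim_I by simp
  with sim_square[OF assms] show ?thesis
    using sim_sym sim_trans by blast
qed

text \<open>Modulo \<open>M\<close> the loop has exponent 2 and, by \<open>sim_RR\<close>, both inverse properties.\<close>

lemma sim_comm:
  assumes "x \<in> Q" "y \<in> Q" shows "L x \<cdot> y \<approx> L y \<cdot> x"
proof -
  let ?u = "L x \<cdot> y"
  have u: "?u \<in> Q" using assms by simp
  have "R y \<cdot> ?u \<approx> x"
    using assms sim_RR[of y x] by (simp add: L_R)
  then have "L ?u \<cdot> L ?u \<cdot> y \<approx> L ?u \<cdot> x"
    using assms by (simp add: L_R[of ?u y] sim_L)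
  then have "y \<approx> R x \<cdot> ?u"
    using sim_LL[OF u assms(2)] assms u by (metis L_R sim_sym sim_trans)
  then have "R x \<cdot> y \<approx> R x \<cdot> R x \<cdot> ?u"
    using assms(1) by (rule sim_R)
  also have "\<dots> \<approx> ?u"
    using sim_RR assms u by blast
  finally show ?thesis
    using assms by (simp add: L_R[of y x] sim_sym)
qed

lemma sim_t:
  assumes "z \<in> Q" "x \<in> Q" shows "t z \<cdot> x \<approx> x"
  using sim_L_minus[OF sim_comm[OF assms(2,1)] assms(1)] assms by (simp add: t_def act_add L_R[of x z])

lemma sim_e_M: "u \<approx> e \<Longrightarrow> u \<in> M"
  by (auto simp: sim_def)

lemma t_N_all:
  assumes "w \<in> Q" "z \<in> Q" shows "t z \<in> N w"
proof (rule N_I)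
  fix y assume y: "y \<in> Q"
  have "- L y \<cdot> t z \<cdot> y \<approx> e"
    using sim_L_minus[OF sim_t[OF assms(2) y] y] y by simp
  then show "perp w (- L y \<cdot> t z \<cdot> y)"
    using assms M_perp sim_e_M by blast
qed (use assms in auto)

lemma t_lassoc: "\<lbrakk>a \<in> Q; y \<in> Q; z \<in> Q; x \<in> Q\<rbrakk> \<Longrightarrow> t x \<cdot> lassoc a y z = lassoc a y z"
  by (simp add: lassoc_H_N t_N_all)

lemma lassoc_commute: "\<lbrakk>a \<in> Q; y \<in> Q; z \<in> Q; x \<in> Q\<rbrakk> \<Longrightarrow> L x \<cdot> lassoc a y z = L (lassoc a y z) \<cdot> x"
  using L_t[of "lassoc a y z" x] by (simp add: t_lassoc)

subsection \<open>Associators lie in the left nucleus\<close>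

lemma L_square_N:
  assumes "x \<in> Q" "w \<in> Q" shows "L x + L x \<in> N w"
  using perp_L_N[OF M_perp[OF square_M]] assms by (simp flip: L_square)

lemma E_LL: assumes "w \<in> Q" "g \<in> E w" "x \<in> Q" shows "conjg (L x) (conjg (L x) g) = g"
  using E_fix[OF assms(2) L_square_N[OF assms(3,1)]] by (simp add: conjg_add)

lemma E_minus_L: assumes "w \<in> Q" "g \<in> E w" "x \<in> Q" shows "conjg (- L x) g = conjg (L x) g"
  using E_LL[OF assms] by (metis conjg_minus_cancel(1))

lemma E_minus_R:
  assumes "w \<in> Q" "g \<in> E w" "x \<in> Q" shows "conjg (- R x) g = conjg (L x) g"
proof -
  have "conjg (- R x) g = conjg (- t x) (conjg (- L x) g)"
    by (simp only: R_eq minus_add conjg_add)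
  also have "\<dots> = conjg (- t x) (conjg (L x) g)"
    using assms by (simp only: E_minus_L)
  also have "\<dots> = conjg (L x) g"
    using assms by (intro E_fix E_conjg N_uminus t_N_all) simp_all
  finally show ?thesis .
qed

lemma conjg_L_lassoc:
  assumes q: "a \<in> Q" "y \<in> Q" "z \<in> Q" and k: "k \<in> H"
    and f: "conjg k (conjg (L y) (h a z)) = f + conjg (L y) (h a z)"
  shows "conjg k (L (lassoc a y z)) = f + L (lassoc a y z)"
proof -
  let ?n = "conjg (L y) (h a z)" and ?p = "L (lassoc a y z)"
  have n: "?n = conjg (- R y) (h a z)"
    using q by (simp add: E_minus_R E_h)
  then have "?n \<cdot> e = ?p \<cdot> e"
    using q by (simp only: lassoc_conj L_e lassoc_Q)
  then have "- ?p + ?n \<in> H"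
    using q by (intro H_I) simp_all
  then have 1: "conjg k (- ?p + ?n) = - ?p + ?n"
    using k by (simp only: H_conjg)
  have 2: "?p + (- ?p + ?n) = ?n"
    by (simp only: group_simps)
  then have "f + (?p + (- ?p + ?n)) = conjg k (?p + (- ?p + ?n))"
    using f by (simp only:)
  also have "\<dots> = conjg k ?p + (- ?p + ?n)"
    using 1 by (simp only: conjg_plus)
  finally show ?thesis
    by (metis add.assoc add_right_imp_eq)
qed

text \<open>\<open>F x z v w y\<close> measures how far \<open>lassoc x z v\<close> is from associating with \<open>w\<close> and \<open>y\<close>. Its value at
  \<open>e\<close> turns out to be symmetric in all five arguments and of order 2, and so \<open>F_sum\<close> forces it to vanish.\<close>

definition F :: "'a \<Rightarrow> 'a \<Rightarrow> 'a \<Rightarrow> 'a \<Rightarrow> 'a \<Rightarrow> 'g" where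
  "F x z v w y = conjg (L (lassoc x z v)) (h w y) + - h w y"

lemma conjg_lassoc_h: "conjg (L (lassoc x z v)) (h w y) = F x z v w y + h w y"
  by (simp only: F_def group_simps)

lemma conjg_h_lassoc: "conjg (h w y) (L (lassoc x z v)) = - F x z v w y + L (lassoc x z v)"
  by (simp only: F_def conjg_def group_simps)

lemma F_E4: "\<lbrakk>x \<in> Q; z \<in> Q; v \<in> Q; w \<in> Q; y \<in> Q\<rbrakk> \<Longrightarrow> F x z v w y \<in> E w"
  unfolding F_def by (intro E_add E_conjg E_uminus E_h) simp_all

lemma F_E1:
  assumes "x \<in> Q" "z \<in> Q" "v \<in> Q" "w \<in> Q" "y \<in> Q" shows "F x z v w y \<in> E x"
proof -
  let ?n = "conjg (L z) (h x v)"
  let ?f = "conjg (h w y) ?n + - ?n"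
  have "conjg (h w y) (L (lassoc x z v)) = ?f + L (lassoc x z v)"
    using assms by (intro conjg_L_lassoc) (simp_all only: h_H group_simps)
  then have "- F x z v w y = ?f"
    unfolding conjg_h_lassoc by (rule add_right_imp_eq)
  moreover have "?f \<in> E x"
    using assms by (intro E_add E_conjg E_uminus E_h) simp_all
  ultimately show ?thesis
    using assms E_uminus by (metis minus_minus)
qed

lemma F_double:
  assumes q: "x \<in> Q" "z \<in> Q" "v \<in> Q" "w \<in> Q" "y \<in> Q" shows "F x z v w y + F x z v w y = 0"
proof -
  let ?p = "L (lassoc x z v)" and ?j = "h w y" and ?F = "F x z v w y"
  have "?j = conjg ?p (conjg ?p ?j)"
    using q by (simp add: E_LL E_h)
  also have "\<dots> = conjg ?p ?F + conjg ?p ?j"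
    by (simp only: conjg_lassoc_h conjg_plus)
  also have "\<dots> = (?F + ?F) + ?j"
    unfolding conjg_lassoc_h using E_fix[OF F_E1[OF q] perp_L_N[OF perp_lassoc(1)]] q by (simp add: add.assoc)
  finally show ?thesis by (metis add_0_left add_right_imp_eq)
qed

lemma F_uminus:
  assumes "x \<in> Q" "z \<in> Q" "v \<in> Q" "w \<in> Q" "y \<in> Q" shows "- F x z v w y = F x z v w y"
  using F_double[OF assms] by (simp add: minus_unique)

lemma conjg_minus_lassoc_h:
  assumes q: "x \<in> Q" "z \<in> Q" "v \<in> Q" "w \<in> Q" "y \<in> Q"
  shows "conjg (- L (lassoc x z v)) (h w y) = F x z v w y + h w y"
  using assms by (simp add: E_minus_L E_h conjg_lassoc_h)

lemma perp_lassoc_closed: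
  assumes "perp q y" "a \<in> Q" "z \<in> Q" shows "perp q (lassoc a y z)"
proof -
  have y: "y \<in> Q" "q \<in> Q" using assms perp_Q by auto
  have "- R y + (h a z + L y) \<in> C q"
    using assms y by (intro C_add C_uminus perp_R_C perp_L_C H_C) simp_all
  then show ?thesis
    using y by (simp add: C_def act_add lassoc_def)
qed

lemma sim_L_M:
  assumes "L q \<cdot> u \<approx> u" "q \<in> Q" "u \<in> Q" shows "q \<in> M"
proof -
  obtain b where "b \<in> M" "L q \<cdot> u = L b \<cdot> u" using assms by (auto simp: sim_def)
  then show ?thesis
    using assms by (simp add: L_R) (metis act_minus(1))
qed

lemma F_swap_13:
  assumes q: "x \<in> Q" "z \<in> Q" "v \<in> Q" "w \<in> Q" "y \<in> Q"
  shows "F v z x w y = F x z v w y"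
proof -
  let ?p = "lassoc x z v" and ?p' = "lassoc v z x" and ?j = "h w y"
  let ?u = "L (L x \<cdot> z) \<cdot> v" and ?u' = "L (L v \<cdot> z) \<cdot> x"
  have "?u' \<approx> L x \<cdot> L v \<cdot> z" using q by (simp add: sim_comm)
  also have "\<dots> \<approx> L x \<cdot> L z \<cdot> v" using q by (simp add: sim_comm sim_L)
  also have "\<dots> = L ?p \<cdot> ?u" using q by (intro lassoc_assoc)
  finally have "L ?p' \<cdot> ?u' \<approx> L ?p' \<cdot> L ?p \<cdot> ?u" using q by (simp add: sim_L)
  moreover have "?u \<approx> L v \<cdot> L x \<cdot> z" using q by (simp add: sim_comm)
  moreover have "L v \<cdot> L x \<cdot> z \<approx> L v \<cdot> L z \<cdot> x" using q by (simp add: sim_comm sim_L)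
  moreover have "L v \<cdot> L z \<cdot> x = L ?p' \<cdot> ?u'" using q by (intro lassoc_assoc)
  ultimately have "L ?p' \<cdot> L ?p \<cdot> ?u \<approx> ?u" by (metis sim_sym sim_trans)
  moreover have perp: "perp ?p' ?p"
    using q by (intro perp_lassoc_closed perp_sym[OF perp_lassoc(2)])
  ultimately have "L ?p' \<cdot> ?p \<in> M"
    using q by (intro sim_L_M[of _ ?u]) (simp_all add: perp_L_mult act_add)
  then have "L (L ?p' \<cdot> ?p) \<in> N w"
    using q by (intro perp_L_N M_perp)
  then have "L ?p' + L ?p \<in> N w"
    using perp by (simp add: perp_L_mult)
  then have "conjg (L ?p') (F x z v w y + ?j) = ?j"
    unfolding conjg_lassoc_h[symmetric] conjg_add[symmetric] using q by (intro E_fix[of _ w] E_h)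
  moreover have "conjg (L ?p') (F x z v w y) = F x z v w y"
    using q by (intro E_fix[of _ x] F_E1 perp_L_N perp_lassoc)
  ultimately have "(F x z v w y + F v z x w y) + ?j = 0 + ?j"
    by (simp add: conjg_plus conjg_lassoc_h add.assoc)
  then have "F x z v w y + F v z x w y = F x z v w y + F x z v w y"
    unfolding F_double[OF q] by (rule add_right_imp_eq)
  then show ?thesis by simp
qed

lemma F_sum:
  assumes q: "x \<in> Q" "z \<in> Q" "v \<in> Q" "w \<in> Q" "y \<in> Q"
  shows "F x v z w y = F z x v w y + F x z v w y"
proof -
  let ?p1 = "lassoc x z v" and ?p2 = "lassoc z x v" and ?p3 = "lassoc x v z" and ?j = "h w y"
  let ?u = "L z \<cdot> L x \<cdot> v"
  have "?u \<approx> L (L x \<cdot> v) \<cdot> z" using q by (simp add: sim_comm)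
  then have "L ?p3 \<cdot> ?u \<approx> L ?p3 \<cdot> L (L x \<cdot> v) \<cdot> z" using q by (simp add: sim_L)
  also have "\<dots> = L x \<cdot> L v \<cdot> z" using q by (intro lassoc_assoc[symmetric])
  also have "\<dots> \<approx> L x \<cdot> L z \<cdot> v" using q by (simp add: sim_comm sim_L)
  also have "\<dots> = L ?p1 \<cdot> R v \<cdot> L x \<cdot> z" using lassoc_assoc[of x z v] q by (simp add: L_R[of "L x \<cdot> z" v])
  also have "\<dots> \<approx> L ?p1 \<cdot> R v \<cdot> L z \<cdot> x" using q by (simp add: sim_comm sim_L sim_R)
  also have "R v \<cdot> L z \<cdot> x = - L ?p2 \<cdot> ?u"
    using lassoc_assoc[of z x v] q by (simp add: L_R[of "L z \<cdot> x" v])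
  finally have "- L ?p1 \<cdot> L ?p3 \<cdot> ?u \<approx> - L ?p2 \<cdot> ?u"
    using sim_L_minus[of _ _ ?p1] q by fastforce
  then have sim: "L ?p2 \<cdot> - L ?p1 \<cdot> L ?p3 \<cdot> ?u \<approx> ?u"
    using sim_L[of _ _ ?p2] q by fastforce
  let ?q = "- L ?p1 \<cdot> e"
  have "perp ?q ?p3"
    using q by (intro perp_sym[OF perp_inverse[OF perp_sym]] perp_lassoc_closed perp_sym[OF perp_lassoc(3)])
  from perp_L_mult[OF this] have r: "L (L ?q \<cdot> ?p3) = - L ?p1 + L ?p3"
    using q by (simp only: L_inverse lassoc_Q)
  have "perp ?p2 (L ?q \<cdot> ?p3)"
    using q by (intro perp_mult perp_inverse perp_lassoc_closed perp_sym[OF perp_lassoc(1)] perp_sym[OF perp_lassoc(3)])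
  then have s: "L (L ?p2 \<cdot> L ?q \<cdot> ?p3) = L ?p2 + (- L ?p1 + L ?p3)"
    by (simp only: perp_L_mult r)
  have "L ?p2 \<cdot> L ?q \<cdot> ?p3 \<in> M"
    by (rule sim_L_M[of _ ?u]) (use q sim in \<open>simp_all only: s act_add, simp_all\<close>)
  then have "L ?p2 + (- L ?p1 + L ?p3) \<in> N w"
    unfolding s[symmetric] using q by (intro perp_L_N M_perp)
  then have "conjg (L ?p2 + (- L ?p1 + L ?p3)) ?j = ?j"
    using q by (intro E_fix[of _ w] E_h)
  then have "conjg (L ?p2) (conjg (- L ?p1) (conjg (L ?p3) ?j)) = ?j"
    by (simp only: conjg_add)
  then have "conjg (L ?p3) ?j = conjg (L ?p1) (conjg (- L ?p2) ?j)"
    by (metis conjg_minus_cancel)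
  also have "\<dots> = conjg (L ?p1) (F z x v w y) + conjg (L ?p1) ?j"
    using q by (simp only: conjg_minus_lassoc_h conjg_plus)
  also have "conjg (L ?p1) (F z x v w y) = F z x v w y"
    using q by (intro E_fix[of _ z] F_E1 perp_L_N perp_lassoc)
  finally have "F x v z w y + ?j = (F z x v w y + F x z v w y) + ?j"
    by (simp only: conjg_lassoc_h add.assoc)
  then show ?thesis by (rule add_right_imp_eq)
qed

lemma F_E2:
  assumes q: "x \<in> Q" "z \<in> Q" "v \<in> Q" "w \<in> Q" "y \<in> Q" shows "F x z v w y \<in> E z"
proof -
  have "F z x v w y + F x v z w y = F x z v w y"
    using q F_double[of z x v w y] by (simp add: F_sum[of x z v w y] flip: add.assoc)
  moreover have "F z x v w y + F x v z w y \<in> E z"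
    using q F_E1[of z v x w y] by (intro E_add F_E1) (simp_all add: F_swap_13)
  ultimately show ?thesis by simp
qed

lemma conjg_L_F:
  assumes "x \<in> Q" "z \<in> Q" "v \<in> Q" "w \<in> Q" "y \<in> Q" "u \<in> {x, z, w}"
  shows "conjg (L u) (F x z v w y) = F x z v w y"
  using assms E_L[OF F_E1] E_L[OF F_E2] E_L[OF F_E4] by (auto simp: F_uminus)

lemma F_swap_14_35:
  assumes q: "x \<in> Q" "z \<in> Q" "v \<in> Q" "w \<in> Q" "y \<in> Q"
  shows "F w z y x v = F x z v w y"
proof -
  let ?p = "lassoc x z v" and ?j = "h w y"
  have comm: "L z + L ?p = L ?p + L z"
    using q by (intro perp_L_commute perp_lassoc lassoc_commute)
  have "h x v \<cdot> z = L ?p \<cdot> z" using q by (simp add: L_lassoc)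
  moreover have "L (L ?p \<cdot> z) = L ?p + L z"
    using q by (intro perp_L_mult perp_sym[OF perp_lassoc(2)])
  ultimately have "conjg (h x v) (conjg (L z) ?j) = conjg (L ?p + L z) ?j"
    using q conjg_c[of "h x v" ?j z] by (simp add: c_def)
  also have "\<dots> = conjg (L z) (conjg (L ?p) ?j)"
    by (simp only: conjg_add flip: comm)
  also have "\<dots> = F x z v w y + conjg (L z) ?j"
    using q by (simp only: conjg_lassoc_h conjg_plus) (simp add: conjg_L_F)
  finally have "conjg (h x v) (L (lassoc w z y)) = F x z v w y + L (lassoc w z y)"
    using q by (intro conjg_L_lassoc) simp_all
  then have "- F w z y x v = F x z v w y"
    unfolding conjg_h_lassoc by (rule add_right_imp_eq)
  then show ?thesis
    using q by (simp add: F_uminus)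
qed

lemma conjg_inner_R_lassoc:
  assumes q: "x \<in> Q" "z \<in> Q" "v \<in> Q" "w \<in> Q" "y \<in> Q"
  shows "conjg (inner_R z v) (L (lassoc w x y)) = F x z v w y + L (lassoc w x y)"
proof (rule conjg_L_lassoc)
  let ?p = "lassoc x z v" and ?j = "h w y"
  have "conjg (inner_R z v) (conjg (L x) ?j) = c ?j (inner_R z v \<cdot> x)"
    using q conjg_c[of "inner_R z v" ?j x] by (simp add: c_def)
  also have "\<dots> = conjg (L x) (conjg (- L ?p) ?j)"
    unfolding c_def inner_R_act[OF q(1-3)] L_minus_lassoc[OF q(1-3)] conjg_add ..
  also have "\<dots> = F x z v w y + conjg (L x) ?j"
    unfolding conjg_minus_lassoc_h[OF q] conjg_plus using q by (simp add: conjg_L_F)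
  finally show "conjg (inner_R z v) (conjg (L x) ?j) = F x z v w y + conjg (L x) ?j" .
qed (use q in simp_all)

lemma L_lassoc_commute:
  assumes q: "a \<in> Q" "y \<in> Q" "z \<in> Q" "y' \<in> Q" "z' \<in> Q"
  shows "L (lassoc a y z) + L (lassoc a y' z') = L (lassoc a y' z') + L (lassoc a y z)"
proof (rule perp_L_commute)
  let ?p = "lassoc a y z" and ?p' = "lassoc a y' z'"
  have a: "perp ?p a" using q by (intro perp_sym[OF perp_lassoc(1)])
  then have "- L (inner_R y' z' \<cdot> a) + L a \<in> C ?p"
    using q by (intro C_add C_uminus perp_L_C perp_H) simp_all
  moreover have "- L (inner_R y' z' \<cdot> a) + L a = L ?p'"
    unfolding inner_R_act[OF q(1,4,5)] L_minus_lassoc[OF q(1,4,5)] by (simp only: group_simps)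
  ultimately show "perp ?p ?p'"
    using q by (simp add: C_def)
  show "L ?p \<cdot> ?p' = L ?p' \<cdot> ?p"
    using q by (intro lassoc_commute) simp_all
qed

lemma inner_R_inner_R_act:
  assumes q: "x \<in> Q" "z \<in> Q" "v \<in> Q" "w \<in> Q" "y \<in> Q"
  shows "inner_R z v \<cdot> inner_R x y \<cdot> w = - L (lassoc w x y) \<cdot> - L (lassoc w z v) \<cdot> L w \<cdot> F x z v w y \<cdot> e"
proof -
  let ?b = "L (lassoc w x y)" and ?d = "L (lassoc w z v)" and ?F = "F x z v w y" and ?r = "inner_R z v"
  have "?r + - ?b = - (?F + ?b) + ?r"
    unfolding conjg_inner_R_lassoc[OF q, symmetric] conjg_uminus[symmetric] by (rule conjg_shift)
  then have "?r \<cdot> - ?b \<cdot> w = - ?b \<cdot> - ?F \<cdot> - ?d \<cdot> w"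
    using inner_R_act[of w z v] q by (metis act_add minus_add)
  also have "\<dots> = - ?b \<cdot> ?F \<cdot> - ?d \<cdot> L w \<cdot> e"
    using q by (simp add: F_uminus)
  also have "conjg (- ?d) ?F = ?F"
    using q by (intro E_fix[OF F_E4] N_uminus perp_L_N perp_lassoc)
  then have "?F \<cdot> - ?d \<cdot> L w \<cdot> e = - ?d \<cdot> ?F \<cdot> L w \<cdot> e"
    unfolding conjg_eq_iff by (metis act_add)
  also have "?F \<cdot> L w \<cdot> e = L w \<cdot> ?F \<cdot> e"
    using conjg_L_F[OF q, of w] unfolding conjg_eq_iff by (metis act_add insertCI)
  finally show ?thesis
    using inner_R_act[of w x y] q by simp
qed

lemma F_e_swap_12_35:
  assumes q: "x \<in> Q" "z \<in> Q" "v \<in> Q" "w \<in> Q" "y \<in> Q"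
  shows "F x z v w y \<cdot> e = F z x y w v \<cdot> e"
proof -
  have "- L (lassoc w x y) \<cdot> - L (lassoc w z v) \<cdot> L w \<cdot> F x z v w y \<cdot> e
      = - L (lassoc w z v) \<cdot> - L (lassoc w x y) \<cdot> L w \<cdot> F z x y w v \<cdot> e"
    using inner_R_inner_R_act[of x z v w y] inner_R_inner_R_act[of z x y w v] H_comm_act[of "inner_R z v" "inner_R x y" w] q by simp
  moreover have "- L (lassoc w x y) + - L (lassoc w z v) = - L (lassoc w z v) + - L (lassoc w x y)"
    using L_lassoc_commute[of w x y z v] q by (simp only: flip: minus_add)
  ultimately have "- L (lassoc w x y) \<cdot> - L (lassoc w z v) \<cdot> L w \<cdot> F x z v w y \<cdot> e
      = - L (lassoc w x y) \<cdot> - L (lassoc w z v) \<cdot> L w \<cdot> F z x y w v \<cdot> e"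
    by (metis act_add)
  then show ?thesis by (metis act_minus)
qed

lemma F_e:
  assumes q: "x \<in> Q" "z \<in> Q" "v \<in> Q" "w \<in> Q" "y \<in> Q" shows "F x z v w y \<cdot> e = e"
proof -
  let ?f = "\<lambda>x z v w y. F x z v w y \<cdot> e"
  have 45: "?f x z v w y = ?f x z v y w" if "x \<in> Q" "z \<in> Q" "v \<in> Q" "w \<in> Q" "y \<in> Q" for x z v w y
    using that by (metis F_swap_13 F_swap_14_35)
  have 34: "?f x z v w y = ?f x z w v y" if "x \<in> Q" "z \<in> Q" "v \<in> Q" "w \<in> Q" "y \<in> Q" for x z v w y
    using F_e_swap_12_35[of x z v w y] 45[of z x y w v] F_e_swap_12_35[of x z w v y] that by simp
  have 35: "?f x z v w y = ?f x z y w v" if "x \<in> Q" "z \<in> Q" "v \<in> Q" "w \<in> Q" "y \<in> Q" for x z v w y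
    using 34[of x z v w y] 45[of x z w v y] 34[of x z w y v] that by simp
  have 12: "?f x z v w y = ?f z x v w y" if "x \<in> Q" "z \<in> Q" "v \<in> Q" "w \<in> Q" "y \<in> Q" for x z v w y
    using F_e_swap_12_35[of x z v w y] 35[of z x y w v] that by simp
  have "F x z v w y \<cdot> e = F v x z w y \<cdot> F x v z w y \<cdot> e"
    using q by (simp add: F_sum[of x v z w y] act_add)
  also have "F x v z w y \<cdot> e = F v x z w y \<cdot> e" using q by (intro 12)
  also have "F v x z w y \<cdot> F v x z w y \<cdot> e = e"
    using F_double[of v x z w y] q by (simp flip: act_add)
  finally show ?thesis .
qed

lemma h_fix_M:
  assumes q: "q \<in> Q" and fix_h: "\<And>w y. \<lbrakk>w \<in> Q; y \<in> Q\<rbrakk> \<Longrightarrow> h w y \<cdot> q = q"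
  shows "q \<in> M"
proof -
  have LR: "L w \<cdot> R y \<cdot> q = R y \<cdot> L w \<cdot> q" if "w \<in> Q" "y \<in> Q" for w y
    using fix_h[OF that] unfolding h_act by (metis act_minus(2))
  have L: "L (L w \<cdot> q) = L w + L q" if "w \<in> Q" for w
  proof (rule faithful)
    fix y assume y: "y \<in> Q"
    have "L (L w \<cdot> q) \<cdot> y = R y \<cdot> L w \<cdot> q" using q that y by (intro L_R) simp_all
    also have "\<dots> = L w \<cdot> R y \<cdot> q" using LR[OF that y] by simp
    also have "R y \<cdot> q = L q \<cdot> y" using q y by (intro L_R[symmetric])
    finally show "L (L w \<cdot> q) \<cdot> y = (L w + L q) \<cdot> y" by (simp only: act_add)
  qed (use q that in simp_all)
  have "L q + R z = R z + L q" if z: "z \<in> Q" for z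
  proof -
    have "- L q + R z = R z + - L q"
    proof (rule faithful)
      fix u assume u: "u \<in> Q"
      have w: "L (- L u \<cdot> q) = - L u + L q"
        using L[of "- L u \<cdot> e"] u by (simp add: L_inverse)
      have "- L (- L u \<cdot> q) \<cdot> e = - L q \<cdot> u"
        unfolding w minus_add using u by (simp add: act_add)
      then have "L (- L q \<cdot> u) = - L q + L u"
        using L_inverse[of "- L u \<cdot> q"] q u by (simp add: w minus_add)
      then have "L (- L q \<cdot> u) \<cdot> z = - L q \<cdot> L u \<cdot> z"
        by (simp only: act_add)
      moreover have "L u \<cdot> z = R z \<cdot> u" "L (- L q \<cdot> u) \<cdot> z = R z \<cdot> - L q \<cdot> u"
        using q u z by (intro L_R; simp)+
      ultimately show "(- L q + R z) \<cdot> u = (R z + - L q) \<cdot> u"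
        by (simp only: act_add)
    qed (use q z in simp_all)
    then show ?thesis
      using commute_uminus[of "R z" "- L q"] by simp
  qed
  with q show ?thesis
    by (intro M_mem) (simp_all add: h_zero_iff)
qed

lemma lassoc_M:
  assumes q: "x \<in> Q" "z \<in> Q" "v \<in> Q" shows "lassoc x z v \<in> M"
proof -
  let ?p = "lassoc x z v"
  have "- L ?p \<cdot> e \<in> M"
  proof (rule h_fix_M)
    fix w y assume "w \<in> Q" "y \<in> Q"
    then have "(L ?p + h w y + - L ?p + - h w y) \<cdot> e = e"
      using F_e[of x z v w y] q by (simp only: F_def conjg_def diff_conv_add_uminus)
    then have "L ?p \<cdot> h w y \<cdot> - L ?p \<cdot> - h w y \<cdot> e = e"
      by (simp only: act_add)
    then show "h w y \<cdot> - L ?p \<cdot> e = - L ?p \<cdot> e"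
      using \<open>w \<in> Q\<close> \<open>y \<in> Q\<close> by (metis H_e H_uminus act_minus(1) h_H)
  qed (use q in simp)
  then have "- L (- L ?p \<cdot> e) \<cdot> e \<in> M" by (rule M_inverse)
  then show ?thesis using q by (simp add: L_inverse)
qed

lemma commutator_rnuc:
  assumes q: "x \<in> Q" "u \<in> Q" "z \<in> Q" "y \<in> Q" and d: "d \<in> M" "t u \<cdot> x = L d \<cdot> x"
  shows "L (L z \<cdot> y) \<cdot> d = L z \<cdot> L y \<cdot> d"
proof -
  let ?p = "lassoc z y x" and ?zy = "L z \<cdot> y"
  let ?l = "- L ?zy + (L z + L y)"
  have p: "?p \<in> M" using q by (intro lassoc_M)
  have comm: "L s + L ?p = L ?p + L s" if "s \<in> Q" for s
    using that q by (intro perp_L_commute M_perp[OF p] lassoc_commute)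
  have l: "?l \<in> H" using q by (intro H_I) (simp_all add: act_add)
  have lx: "?l \<cdot> x = L ?p \<cdot> x"
    using lassoc_assoc[of z y x] comm[of ?zy] q by (simp add: act_add) (metis act_add act_minus(1))
  have "?l \<cdot> L d \<cdot> x = t u \<cdot> L ?p \<cdot> x"
    using H_comm_act[OF l t_H[of u], of x] q by (simp only: lx flip: d(2))
  also have "\<dots> = L ?p \<cdot> L d \<cdot> x"
    using lassoc_H_N(1)[of z y x "t u"] t_N_all[of z u] q by (metis d(2) act_add t_H)
  finally have "L z \<cdot> L y \<cdot> L d \<cdot> x = L ?zy \<cdot> L ?p \<cdot> L d \<cdot> x"
    by (simp only: act_add) (metis act_minus(2))
  then have 1: "L z \<cdot> L y \<cdot> L d \<cdot> x = L ?p \<cdot> L ?zy \<cdot> L d \<cdot> x"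
    using comm[of ?zy] q by (metis G_Q L_G act_add)
  obtain d1 where d1: "d1 \<in> M" "L y + L d = L d1 + L y" using L_M_swap d(1) q by blast
  obtain d2 where d2: "d2 \<in> M" "L z + L d1 = L d2 + L z" using L_M_swap d1(1) q by blast
  have "L z \<cdot> L y \<cdot> L d \<cdot> x = L d2 \<cdot> L z \<cdot> L y \<cdot> x"
    using d1(2) d2(2) by (metis act_add)
  also have "\<dots> = L ?p \<cdot> L d2 \<cdot> L ?zy \<cdot> x"
    unfolding lassoc_assoc[OF q(3,4,1)] using comm[of d2] d2(1) by (metis M_Q act_add)
  finally have "L ?zy \<cdot> L d \<cdot> x = L d2 \<cdot> L ?zy \<cdot> x"
    unfolding 1 by (metis act_minus(1))
  then have "L (L ?zy \<cdot> d) \<cdot> x = L (L d2 \<cdot> ?zy) \<cdot> x"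
    using d(1) d2(1) q by (simp add: L_M_left L_M_right act_add)
  then have "L ?zy \<cdot> d = L d2 \<cdot> ?zy"
    using d(1) d2(1) q by (simp add: L_R[of _ x]) (metis act_minus(1))
  also have "\<dots> = L z \<cdot> L d1 \<cdot> L y \<cdot> e"
    using d2(2) q by (metis L_e act_add)
  also have "L d1 \<cdot> L y \<cdot> e = L y \<cdot> d"
    using d1(2) d(1) by (metis L_e M_Q act_add)
  finally show ?thesis .
qed

end

subsection \<open>Quotients and the upper central series\<close>

locale aim_lc_mult = aim_lc act G Q e L R
  for act :: "'g::group_add \<Rightarrow> 'a \<Rightarrow> 'a" (infixr "\<cdot>" 75) and G Q e L R +
  fixes m :: "'a \<Rightarrow> 'a \<Rightarrow> 'a"
  assumes m_L: "\<lbrakk>x \<in> Q; y \<in> Q\<rbrakk> \<Longrightarrow> m x y = L x \<cdot> y"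
begin

lemma m_R: "\<lbrakk>x \<in> Q; y \<in> Q\<rbrakk> \<Longrightarrow> m x y = R y \<cdot> x"
  by (simp add: m_L L_R)

lemma m_Q [simp]: "\<lbrakk>x \<in> Q; y \<in> Q\<rbrakk> \<Longrightarrow> m x y \<in> Q"
  by (simp add: m_L)

definition invariant_subloop :: "'a set \<Rightarrow> bool" where
  "invariant_subloop S \<longleftrightarrow> S \<subseteq> Q \<and> e \<in> S \<and> (\<forall>x\<in>S. \<forall>y\<in>S. L x \<cdot> y \<in> S) \<and>
     (\<forall>x\<in>S. - L x \<cdot> e \<in> S) \<and> (\<forall>k\<in>H. \<forall>x\<in>S. k \<cdot> x \<in> S)"

definition K :: "'a set \<Rightarrow> 'g set" where "K S = {g \<in> G. g \<cdot> e \<in> S}"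

lemma K_I: "\<lbrakk>g \<in> G; g \<cdot> e \<in> S\<rbrakk> \<Longrightarrow> g \<in> K S"
  by (simp add: K_def)

lemma K_D: "g \<in> K S \<Longrightarrow> g \<in> G" "g \<in> K S \<Longrightarrow> g \<cdot> e \<in> S"
  by (simp_all add: K_def)

lemma invariant_Q: "invariant_subloop S \<Longrightarrow> x \<in> S \<Longrightarrow> x \<in> Q"
  by (auto simp: invariant_subloop_def)

lemma invariant_e: "invariant_subloop S \<Longrightarrow> e \<in> S"
  by (simp add: invariant_subloop_def)

lemma invariant_mult: "\<lbrakk>invariant_subloop S; x \<in> S; y \<in> S\<rbrakk> \<Longrightarrow> L x \<cdot> y \<in> S"
  by (simp add: invariant_subloop_def)

lemma invariant_inverse: "\<lbrakk>invariant_subloop S; x \<in> S\<rbrakk> \<Longrightarrow> - L x \<cdot> e \<in> S"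
  by (simp add: invariant_subloop_def)

lemma invariant_H: "\<lbrakk>invariant_subloop S; x \<in> S; k \<in> H\<rbrakk> \<Longrightarrow> k \<cdot> x \<in> S"
  by (simp add: invariant_subloop_def)

lemma H_K: "\<lbrakk>invariant_subloop S; k \<in> H\<rbrakk> \<Longrightarrow> k \<in> K S"
  by (rule K_I) (simp_all add: invariant_e)

lemma K_split:
  assumes "invariant_subloop S" "f \<in> K S"
  obtains k where "k \<in> H" "f = L (f \<cdot> e) + k"
proof
  have f: "f \<in> G" "f \<cdot> e \<in> Q" using assms K_D invariant_Q by blast+
  show "- L (f \<cdot> e) + f \<in> H" using f by (intro H_I) simp_all
  show "f = L (f \<cdot> e) + (- L (f \<cdot> e) + f)" by (simp only: group_simps)
qed

lemma K_add:
  assumes S: "invariant_subloop S" and f: "f \<in> K S" and g: "g \<in> K S" shows "f + g \<in> K S"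
proof (rule K_I)
  obtain k where k: "k \<in> H" "f = L (f \<cdot> e) + k" using K_split[OF S f] .
  have "k \<cdot> g \<cdot> e \<in> S" using S g k by (intro invariant_H K_D)
  then have "L (f \<cdot> e) \<cdot> k \<cdot> g \<cdot> e \<in> S" using S f by (intro invariant_mult K_D)
  then show "(f + g) \<cdot> e \<in> S" using k(2) by (metis act_add)
qed (use f g K_D in auto)

lemma K_uminus:
  assumes S: "invariant_subloop S" and f: "f \<in> K S" shows "- f \<in> K S"
proof (rule K_I)
  obtain k where k: "k \<in> H" "f = L (f \<cdot> e) + k" using K_split[OF S f] .
  have "- k \<cdot> - L (f \<cdot> e) \<cdot> e \<in> S"
    using S f k by (intro invariant_H invariant_inverse K_D) simp_all
  then show "- f \<cdot> e \<in> S" using k(2) by (metis act_add minus_add)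
qed (use f K_D in auto)

lemma L_K: "\<lbrakk>invariant_subloop S; x \<in> S\<rbrakk> \<Longrightarrow> L x \<in> K S"
  by (rule K_I) (simp_all add: invariant_Q)

lemma R_K: "\<lbrakk>invariant_subloop S; x \<in> S\<rbrakk> \<Longrightarrow> R x \<in> K S"
  by (rule K_I) (simp_all add: invariant_Q)

definition rel :: "'a set \<Rightarrow> 'a \<Rightarrow> 'a \<Rightarrow> bool" where
  "rel S x y \<longleftrightarrow> x \<in> Q \<and> y \<in> Q \<and> - L x \<cdot> y \<in> S"

lemma rel_Q: "rel S x y \<Longrightarrow> x \<in> Q" "rel S x y \<Longrightarrow> y \<in> Q"
  by (simp_all add: rel_def)

lemma rel_K: "\<lbrakk>x \<in> Q; y \<in> Q\<rbrakk> \<Longrightarrow> rel S x y \<longleftrightarrow> - L x + L y \<in> K S"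
  by (simp add: rel_def K_def act_add)

lemma rel_refl: "\<lbrakk>invariant_subloop S; x \<in> Q\<rbrakk> \<Longrightarrow> rel S x x"
  by (simp add: rel_def invariant_e)

lemma rel_sym:
  assumes "invariant_subloop S" "rel S x y" shows "rel S y x"
proof -
  have "x \<in> Q" "y \<in> Q" using assms rel_Q by auto
  moreover from this have "- (- L x + L y) \<in> K S"
    using assms by (intro K_uminus) (simp_all add: rel_K)
  moreover have "- (- L x + L y) = - L y + L x" by (simp only: group_simps)
  ultimately show ?thesis by (simp only: rel_K)
qed

lemma rel_trans:
  assumes "invariant_subloop S" "rel S x y" "rel S y z" shows "rel S x z"
proof -
  have q: "x \<in> Q" "y \<in> Q" "z \<in> Q" using assms rel_Q by auto
  then have "- L x + L y \<in> K S" "- L y + L z \<in> K S"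
    using assms by (simp_all only: rel_K)
  then have "(- L x + L y) + (- L y + L z) \<in> K S"
    by (rule K_add[OF assms(1)])
  moreover have "(- L x + L y) + (- L y + L z) = - L x + L z" by (simp only: group_simps)
  ultimately show ?thesis using q by (simp only: rel_K)
qed

lemma rel_act:
  assumes "invariant_subloop S" "rel S x y" "g \<in> G" shows "rel S (g \<cdot> x) (g \<cdot> y)"
proof -
  have q: "x \<in> Q" "y \<in> Q" using assms rel_Q by auto
  have "- L (g \<cdot> x) + (g + L x) \<in> H" using q assms by (intro H_I) (simp_all add: act_add)
  moreover have "- L x + L y \<in> K S" using assms(2) q by (simp only: rel_K)
  ultimately have "(- L (g \<cdot> x) + (g + L x)) + (- L x + L y) \<in> K S"
    by (rule K_add[OF assms(1) H_K[OF assms(1)]])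
  moreover have "(- L (g \<cdot> x) + (g + L x)) + (- L x + L y) = - L (g \<cdot> x) + (g + L y)"
    by (simp only: group_simps)
  ultimately show ?thesis
    using q assms by (simp add: K_def rel_def act_add)
qed

lemma rel_mult:
  assumes S: "invariant_subloop S" and "rel S x x'" "rel S y y'"
  shows "rel S (m x y) (m x' y')"
proof -
  have q: "x \<in> Q" "x' \<in> Q" "y \<in> Q" "y' \<in> Q" using assms rel_Q by auto
  have "rel S (m x y) (m x y')"
    using rel_act[OF S assms(3), of "L x"] q by (simp add: m_L)
  moreover have "rel S (m x y') (m x' y')"
    using rel_act[OF S assms(2), of "R y'"] q by (simp add: m_R)
  ultimately show ?thesis using S rel_trans by blast
qed

lemma rel_cancel_left:
  assumes "invariant_subloop S" "rel S (m x y) (m x z)" "x \<in> Q" "y \<in> Q" "z \<in> Q" shows "rel S y z"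
  using rel_act[OF assms(1,2), of "- L x"] assms by (simp add: m_L)

lemma rel_cancel_right:
  assumes "invariant_subloop S" "rel S (m y x) (m z x)" "x \<in> Q" "y \<in> Q" "z \<in> Q" shows "rel S y z"
  using rel_act[OF assms(1,2), of "- R x"] assms by (simp add: m_R)

lemma lcoset_eq:
  assumes "invariant_subloop S" "x \<in> Q" shows "lcoset m x S = {y. rel S x y}"
proof (intro set_eqI iffI; simp only: mem_Collect_eq)
  fix y assume "y \<in> lcoset m x S"
  then show "rel S x y"
    using assms by (auto simp: lcoset_def rel_def m_L invariant_Q)
next
  fix y assume "rel S x y"
  then have "- L x \<cdot> y \<in> S" "y = m x (- L x \<cdot> y)"
    using assms by (simp_all add: rel_def m_L)
  then show "y \<in> lcoset m x S" by (auto simp: lcoset_def)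
qed

lemma lcoset_eq_iff:
  assumes "invariant_subloop S" "x \<in> Q" "y \<in> Q"
  shows "lcoset m x S = lcoset m y S \<longleftrightarrow> rel S x y"
proof
  assume "lcoset m x S = lcoset m y S"
  then show "rel S x y"
    using rel_refl[OF assms(1,3)] unfolding lcoset_eq[OF assms(1,2)] lcoset_eq[OF assms(1,3)] by blast
next
  assume "rel S x y"
  then show "lcoset m x S = lcoset m y S"
    unfolding lcoset_eq[OF assms(1,2)] lcoset_eq[OF assms(1,3)]
    using rel_sym[OF assms(1)] rel_trans[OF assms(1)] by blast
qed

lemma L_e_zero: "L e = 0"
  by (rule faithful) simp_all

lemma lcoset_e: "invariant_subloop S \<Longrightarrow> lcoset m e S = S"
  by (auto simp: lcoset_eq rel_def L_e_zero invariant_Q)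

lemma qmult_lcoset:
  assumes S: "invariant_subloop S" and q: "x \<in> Q" "y \<in> Q"
  shows "qmult m S (lcoset m x S) (lcoset m y S) = lcoset m (m x y) S"
proof -
  have some: "rel S z (SOME a. a \<in> lcoset m z S)" if "z \<in> Q" for z
    using someI[of "\<lambda>a. a \<in> lcoset m z S" z] S that by (simp add: lcoset_eq rel_refl)
  then have "rel S (m x y) (m (SOME a. a \<in> lcoset m x S) (SOME b. b \<in> lcoset m y S))"
    using S q by (intro rel_mult)
  then show ?thesis
    unfolding qmult_def using S rel_Q by (metis lcoset_eq_iff)
qed

lemma qcarrier_E:
  assumes "A \<in> qcarrier Q m S" obtains x where "x \<in> Q" "A = lcoset m x S"
  using assms by (auto simp: qcarrier_def)

lemma lcoset_qcarrier: "x \<in> Q \<Longrightarrow> lcoset m x S \<in> qcarrier Q m S"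
  by (auto simp: qcarrier_def)

lemma ball_qcarrier: "(\<forall>A\<in>qcarrier Q m S. P A) \<longleftrightarrow> (\<forall>x\<in>Q. P (lcoset m x S))"
  by (auto simp: qcarrier_def)

lemma is_loop_quotient:
  assumes S: "invariant_subloop S" shows "is_loop (qcarrier Q m S) (qmult m S) S"
  unfolding is_loop_def
proof (intro conjI ballI)
  show "S \<in> qcarrier Q m S"
    using lcoset_qcarrier[OF e_Q, of S] by (simp add: lcoset_e[OF S])
  fix A assume "A \<in> qcarrier Q m S"
  then obtain x where x: "x \<in> Q" "A = lcoset m x S" by (rule qcarrier_E)
  show "qmult m S S A = A" "qmult m S A S = A"
    using qmult_lcoset[OF S e_Q x(1)] qmult_lcoset[OF S x(1) e_Q] x lcoset_e[OF S]
    by (simp_all add: m_L)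
  show "qmult m S A B \<in> qcarrier Q m S" if "B \<in> qcarrier Q m S" for B
    using that S x by (auto elim!: qcarrier_E simp: qmult_lcoset lcoset_qcarrier)
  show "bij_betw (qmult m S A) (qcarrier Q m S) (qcarrier Q m S)"
  proof (rule bij_betw_imageI)
    show "inj_on (qmult m S A) (qcarrier Q m S)"
      using S x rel_cancel_left[OF S] by (simp add: inj_on_def ball_qcarrier qmult_lcoset lcoset_eq_iff)
    show "qmult m S A ` qcarrier Q m S = qcarrier Q m S"
    proof (intro equalityI subsetI)
      fix B assume "B \<in> qcarrier Q m S"
      then obtain y where y: "y \<in> Q" "B = lcoset m y S" by (rule qcarrier_E)
      then have "B = qmult m S A (lcoset m (- L x \<cdot> y) S)"
        using S x by (simp add: qmult_lcoset m_L)
      then show "B \<in> qmult m S A ` qcarrier Q m S"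
        using x y by (auto intro!: imageI lcoset_qcarrier)
    qed (use S x in \<open>auto elim!: qcarrier_E simp: qmult_lcoset lcoset_qcarrier\<close>)
  qed
  show "bij_betw (\<lambda>B. qmult m S B A) (qcarrier Q m S) (qcarrier Q m S)"
  proof (rule bij_betw_imageI)
    show "inj_on (\<lambda>B. qmult m S B A) (qcarrier Q m S)"
      using S x rel_cancel_right[OF S] by (simp add: inj_on_def ball_qcarrier qmult_lcoset lcoset_eq_iff)
    show "(\<lambda>B. qmult m S B A) ` qcarrier Q m S = qcarrier Q m S"
    proof (intro equalityI subsetI)
      fix B assume "B \<in> qcarrier Q m S"
      then obtain y where y: "y \<in> Q" "B = lcoset m y S" by (rule qcarrier_E)
      then have "B = qmult m S (lcoset m (- R x \<cdot> y) S) A"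
        using S x by (simp add: qmult_lcoset m_R)
      then show "B \<in> (\<lambda>B. qmult m S B A) ` qcarrier Q m S"
        using x y by (auto intro!: imageI lcoset_qcarrier)
    qed (use S x in \<open>auto elim!: qcarrier_E simp: qmult_lcoset lcoset_qcarrier\<close>)
  qed
qed

lemma is_group_quotient:
  assumes S: "invariant_subloop S"
    and assoc: "\<And>x y z. \<lbrakk>x \<in> Q; y \<in> Q; z \<in> Q\<rbrakk> \<Longrightarrow> rel S (m (m x y) z) (m x (m y z))"
  shows "is_group_loop (qcarrier Q m S) (qmult m S) S"
  unfolding is_group_loop_def
  using S assoc is_loop_quotient[OF S] by (simp add: ball_qcarrier qmult_lcoset lcoset_eq_iff)

definition central :: "'a set \<Rightarrow> 'a \<Rightarrow> bool" where
  "central S x \<longleftrightarrow> (\<forall>y\<in>Q. rel S (m x y) (m y x)) \<and>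
     (\<forall>y\<in>Q. \<forall>z\<in>Q. rel S (m (m x y) z) (m x (m y z)) \<and> rel S (m (m y z) x) (m y (m z x)) \<and>
       rel S (m (m y x) z) (m y (m x z)))"

lemma center_quotient:
  assumes "invariant_subloop S" "x \<in> Q"
  shows "lcoset m x S \<in> center (qcarrier Q m S) (qmult m S) \<longleftrightarrow> central S x"
  unfolding center_def commutant_def nucleus_def lnuc_def rnuc_def mnuc_def central_def
  using assms by (simp add: ball_qcarrier lcoset_qcarrier qmult_lcoset lcoset_eq_iff) blast

lemma upper_center_Suc:
  assumes "invariant_subloop (upper_center Q m e i)"
  shows "upper_center Q m e (Suc i) = {x \<in> Q. central (upper_center Q m e i) x}"
  using center_quotient[OF assms] by auto

lemma ldiv_eq: "\<lbrakk>x \<in> Q; y \<in> Q\<rbrakk> \<Longrightarrow> ldiv Q m x y = - L x \<cdot> y"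
  unfolding ldiv_def by (rule the_equality) (auto simp: m_L)

lemma rdiv_eq: "\<lbrakk>x \<in> Q; y \<in> Q\<rbrakk> \<Longrightarrow> rdiv Q m x y = - R y \<cdot> x"
  unfolding rdiv_def by (rule the_equality) (auto simp: m_R)

lemma subloop_invariant:
  assumes S: "invariant_subloop S" shows "subloop Q m S"
  unfolding subloop_def
proof (intro conjI ballI)
  show "S \<noteq> {}" "S \<subseteq> Q" using S invariant_e invariant_Q by auto
  fix x y assume xy: "x \<in> S" "y \<in> S"
  then have q: "x \<in> Q" "y \<in> Q" using S invariant_Q by auto
  show "m x y \<in> S" using S xy q by (simp add: m_L invariant_mult)
  have "- L x + L y \<in> K S" "- R y + L x \<in> K S"
    using S xy by (intro K_add K_uminus L_K R_K; simp)+
  then show "ldiv Q m x y \<in> S" "rdiv Q m x y \<in> S"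
    using q by (simp_all add: ldiv_eq rdiv_eq K_def act_add)
qed

lemma lnuc_eq: "lnuc Q m = M"
proof (intro set_eqI iffI)
  fix a assume a: "a \<in> lnuc Q m"
  then have q: "a \<in> Q" by (simp add: lnuc_def)
  show "a \<in> M"
  proof (rule M_mem[OF q])
    fix y assume y: "y \<in> Q"
    have "L a + R y = R y + L a"
    proof (rule faithful)
      fix x assume x: "x \<in> Q"
      have "m (m a x) y = m a (m x y)" using a x y by (simp add: lnuc_def)
      then show "(L a + R y) \<cdot> x = (R y + L a) \<cdot> x"
        using q x y by (simp add: act_add m_R[of _ y] m_L[of a])
    qed (use q y in simp_all)
    then show "h a y = 0" by (simp add: h_zero_iff)
  qed
next
  fix a assume a: "a \<in> M"
  then show "a \<in> lnuc Q m"
    using L_M_left[OF a] by (simp add: lnuc_def m_L act_add)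
qed

lemma nucleus_iff: "a \<in> nucleus Q m \<longleftrightarrow> a \<in> M \<and> (\<forall>x\<in>Q. \<forall>y\<in>Q. L (L x \<cdot> y) \<cdot> a = L x \<cdot> L y \<cdot> a)"
proof -
  have "a \<in> mnuc Q m" if a: "a \<in> M"
    using L_M_right[OF a] a by (simp add: mnuc_def m_L act_add)
  then show ?thesis
    unfolding nucleus_def lnuc_eq by (auto simp: rnuc_def m_L)
qed

lemma center_iff: "a \<in> center Q m \<longleftrightarrow> a \<in> M \<and> (\<forall>x\<in>Q. L x \<cdot> a = L a \<cdot> x)"
proof -
  have "L (L x \<cdot> y) \<cdot> a = L x \<cdot> L y \<cdot> a"
    if a: "a \<in> M" and comm: "\<forall>x\<in>Q. L x \<cdot> a = L a \<cdot> x" and q: "x \<in> Q" "y \<in> Q" for x y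
  proof -
    have "L x + L a = L a + L x"
      using comm q a by (intro perp_L_commute M_perp) simp_all
    then have "L x \<cdot> L a \<cdot> y = L a \<cdot> L x \<cdot> y" by (metis act_add)
    then show ?thesis using comm q by simp
  qed
  then show ?thesis
    by (auto simp: center_def commutant_def nucleus_iff m_L)
qed

lemma nucleus_invariant: "invariant_subloop (nucleus Q m)"
  unfolding invariant_subloop_def
proof (intro conjI ballI)
  show "nucleus Q m \<subseteq> Q" by (auto simp: nucleus_iff)
  show "e \<in> nucleus Q m" by (simp add: nucleus_iff)
next
  fix a b assume "a \<in> nucleus Q m" "b \<in> nucleus Q m"
  then have a: "a \<in> M" "\<And>x y. \<lbrakk>x \<in> Q; y \<in> Q\<rbrakk> \<Longrightarrow> L (L x \<cdot> y) \<cdot> a = L x \<cdot> L y \<cdot> a"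
    and b: "b \<in> M" "\<And>x y. \<lbrakk>x \<in> Q; y \<in> Q\<rbrakk> \<Longrightarrow> L (L x \<cdot> y) \<cdot> b = L x \<cdot> L y \<cdot> b"
    by (auto simp: nucleus_iff)
  have "L (L x \<cdot> y) \<cdot> L a \<cdot> b = L x \<cdot> L y \<cdot> L a \<cdot> b" if q: "x \<in> Q" "y \<in> Q" for x y
  proof -
    have "L (L x \<cdot> y) \<cdot> L a \<cdot> b = L (L (L x \<cdot> y) \<cdot> a) \<cdot> b"
      using a(1) b(1) q by (simp add: b(2))
    also have "\<dots> = L (L x \<cdot> L y \<cdot> a) \<cdot> b"
      using a(2) q by simp
    also have "\<dots> = L x \<cdot> L y \<cdot> L a \<cdot> b"
      using a(1) b(1) q by (simp add: b(2))
    finally show ?thesis .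
  qed
  then show "L a \<cdot> b \<in> nucleus Q m"
    using a(1) b(1) by (simp add: nucleus_iff M_mult)
next
  fix a assume "a \<in> nucleus Q m"
  then have a: "a \<in> M" "\<And>x y. \<lbrakk>x \<in> Q; y \<in> Q\<rbrakk> \<Longrightarrow> L (L x \<cdot> y) \<cdot> a = L x \<cdot> L y \<cdot> a"
    by (auto simp: nucleus_iff)
  let ?b = "- L a \<cdot> e"
  have ba: "L ?b \<cdot> a = e" using a(1) by (simp add: L_inverse)
  have inv: "R a \<cdot> L y \<cdot> ?b = y" if "y \<in> Q" for y
    using a(2)[of y ?b] a(1) that ba by (simp add: L_R[of _ a, symmetric])
  have "L (L x \<cdot> y) \<cdot> ?b = L x \<cdot> L y \<cdot> ?b" if q: "x \<in> Q" "y \<in> Q" for x y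
  proof -
    have "R a \<cdot> L x \<cdot> L y \<cdot> ?b = L x \<cdot> R a \<cdot> L y \<cdot> ?b"
      using a(2)[of x "L y \<cdot> ?b"] a(1) q by (simp add: L_R[of _ a, symmetric])
    also have "\<dots> = R a \<cdot> L (L x \<cdot> y) \<cdot> ?b"
      using q by (simp add: inv)
    finally show ?thesis by (metis act_minus(1))
  qed
  then show "?b \<in> nucleus Q m"
    using a(1) by (simp add: nucleus_iff M_inverse)
next
  fix k a assume k: "k \<in> H" and "a \<in> nucleus Q m"
  then have a: "a \<in> M" "\<And>x y. \<lbrakk>x \<in> Q; y \<in> Q\<rbrakk> \<Longrightarrow> L (L x \<cdot> y) \<cdot> a = L x \<cdot> L y \<cdot> a"
    by (auto simp: nucleus_iff)
  have "L (L x \<cdot> y) \<cdot> k \<cdot> a = L x \<cdot> L y \<cdot> k \<cdot> a" if q: "x \<in> Q" "y \<in> Q" for x y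
  proof -
    let ?l = "- L (L x \<cdot> y) + (L x + L y)"
    have l: "?l \<in> H" using q by (intro H_I) (simp_all add: act_add)
    have "?l \<cdot> a = a" using a(2)[OF q] by (metis act_add act_minus(1))
    then have "?l \<cdot> k \<cdot> a = k \<cdot> a" using H_comm_act[OF l k, of a] by simp
    then show ?thesis by (metis act_add act_minus(2))
  qed
  then show "k \<cdot> a \<in> nucleus Q m"
    using a(1) k by (simp add: nucleus_iff M_H)
qed

lemma center_L:
  assumes "a \<in> center Q m" "x \<in> Q" shows "L x + L a = L a + L x"
  using assms by (intro perp_L_commute M_perp) (auto simp: center_iff)

lemma center_invariant: "invariant_subloop (center Q m)"
  unfolding invariant_subloop_def
proof (intro conjI ballI)
  show "center Q m \<subseteq> Q" by (auto simp: center_iff)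
  show "e \<in> center Q m" by (simp add: center_iff)
next
  fix a b assume a: "a \<in> center Q m" and b: "b \<in> center Q m"
  then have M: "a \<in> M" "b \<in> M" by (simp_all add: center_iff)
  have "L x \<cdot> L a \<cdot> b = L (L a \<cdot> b) \<cdot> x" if x: "x \<in> Q" for x
  proof -
    have "L x \<cdot> L a \<cdot> b = L a \<cdot> L x \<cdot> b"
      using center_L[OF a x] by (metis act_add)
    also have "L x \<cdot> b = L b \<cdot> x" using b x by (simp add: center_iff)
    finally show ?thesis using M by (simp add: L_M_left act_add)
  qed
  then show "L a \<cdot> b \<in> center Q m"
    using M by (simp add: center_iff M_mult)
next
  fix a assume a: "a \<in> center Q m"
  then have M: "a \<in> M" by (simp add: center_iff)
  have "L x \<cdot> - L a \<cdot> e = L (- L a \<cdot> e) \<cdot> x" if x: "x \<in> Q" for x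
  proof -
    have "L x \<cdot> - L a \<cdot> e = - L a \<cdot> L x \<cdot> e"
      using commute_uminus[OF center_L[OF a x]] by (metis act_add)
    then show ?thesis using M x by (simp add: L_inverse)
  qed
  then show "- L a \<cdot> e \<in> center Q m"
    using M by (simp add: center_iff M_inverse)
next
  fix k a assume k: "k \<in> H" and "a \<in> center Q m"
  then have a: "a \<in> M" "\<And>x. x \<in> Q \<Longrightarrow> L x \<cdot> a = L a \<cdot> x" by (simp_all add: center_iff)
  have "L x \<cdot> k \<cdot> a = L (k \<cdot> a) \<cdot> x" if x: "x \<in> Q" for x
  proof -
    have "L x \<cdot> t x \<cdot> a = L x \<cdot> a" using a x by (simp only: L_t a(2) M_Q)
    then have "t x \<cdot> a = a" by (metis act_minus(1))
    then have "t x \<cdot> k \<cdot> a = k \<cdot> a" using H_comm_act[OF t_H[OF x] k, of a] by simp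
    then show ?thesis using L_t[of "k \<cdot> a" x] a(1) k x by simp
  qed
  then show "k \<cdot> a \<in> center Q m"
    using a(1) k by (simp add: center_iff M_H)
qed

lemma center_nucleus: "center Q m \<subseteq> nucleus Q m"
  by (auto simp: center_def)

lemma rel_mono: "\<lbrakk>rel S x y; S \<subseteq> S'\<rbrakk> \<Longrightarrow> rel S' x y"
  by (auto simp: rel_def)

lemma assoc_center:
  assumes q: "x \<in> Q" "y \<in> Q" "z \<in> Q"
  shows "rel (center Q m) (m (m x y) z) (m x (m y z))"
proof -
  let ?p = "lassoc x y z" and ?u = "L (L x \<cdot> y) \<cdot> z"
  have "?p \<in> center Q m"
    using q lassoc_M lassoc_commute by (simp add: center_iff)
  moreover have "- L ?u \<cdot> L x \<cdot> L y \<cdot> z = ?p"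
    unfolding lassoc_assoc[OF q] using q by (simp flip: lassoc_commute)
  ultimately show ?thesis
    using q by (simp add: rel_def m_L)
qed

lemma commute_nucleus:
  assumes q: "x \<in> Q" "y \<in> Q" shows "rel (nucleus Q m) (m x y) (m y x)"
proof -
  from sim_t[OF q(1,2)] obtain d where d: "d \<in> M" "t x \<cdot> y = L d \<cdot> y" by (auto simp: sim_def)
  have "d \<in> nucleus Q m"
    using d q commutator_rnuc[of y x _ _ d] by (simp add: nucleus_iff)
  then have "t y \<cdot> d \<in> nucleus Q m"
    using nucleus_invariant q by (simp add: invariant_H)
  moreover have "- L y \<cdot> t x \<cdot> y = t y \<cdot> d"
    using d q by (simp add: t_def[of y] act_add L_R)
  ultimately have "rel (nucleus Q m) y (t x \<cdot> y)"
    using q by (simp add: rel_def)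
  then have "rel (nucleus Q m) (L x \<cdot> y) (L x \<cdot> t x \<cdot> y)"
    using q by (intro rel_act nucleus_invariant) simp_all
  then show ?thesis using q by (simp add: L_t m_L)
qed

lemma nucleus_quotient:
  "is_abelian_group_loop (qcarrier Q m (nucleus Q m)) (qmult m (nucleus Q m)) (nucleus Q m)"
  unfolding is_abelian_group_loop_def
proof
  show "is_group_loop (qcarrier Q m (nucleus Q m)) (qmult m (nucleus Q m)) (nucleus Q m)"
    by (intro is_group_quotient nucleus_invariant rel_mono[OF assoc_center center_nucleus])
  show "\<forall>A\<in>qcarrier Q m (nucleus Q m). \<forall>B\<in>qcarrier Q m (nucleus Q m).
      qmult m (nucleus Q m) A B = qmult m (nucleus Q m) B A"
    using nucleus_invariant commute_nucleus by (simp add: ball_qcarrier qmult_lcoset lcoset_eq_iff)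
qed

lemma center_quotient_group:
  "is_group_loop (qcarrier Q m (center Q m)) (qmult m (center Q m)) (center Q m)"
  by (intro is_group_quotient center_invariant assoc_center)

lemma trivial_invariant: "invariant_subloop {e}"
  by (simp add: invariant_subloop_def L_e_zero)

lemma rel_trivial: "rel {e} x y \<longleftrightarrow> x \<in> Q \<and> x = y"
proof -
  have "y = x" if "x \<in> Q" "- L x \<cdot> y = e"
    using that by (metis L_e act_minus(2))
  then show ?thesis by (auto simp: rel_def)
qed

lemma upper_center_1: "upper_center Q m e 1 = center Q m"
proof -
  have "upper_center Q m e 1 = {x \<in> Q. central {e} x}"
    using upper_center_Suc[of 0] trivial_invariant by simp
  then show ?thesis
    by (auto simp: central_def rel_trivial center_def commutant_def nucleus_def lnuc_def rnuc_def mnuc_def)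
qed

lemma upper_center_2:
  "upper_center Q m e 2 = {x \<in> Q. \<forall>y\<in>Q. rel (center Q m) (m x y) (m y x)}"
proof -
  have "upper_center Q m e 2 = {x \<in> Q. central (center Q m) x}"
    using upper_center_Suc[of 1] center_invariant upper_center_1 by (simp add: numeral_2_eq_2)
  then show ?thesis
    using assoc_center by (auto simp: central_def)
qed

lemmas relZ_trans [trans] = rel_trans[OF center_invariant]
lemmas relZ_sym = rel_sym[OF center_invariant]
lemmas relZ_refl = rel_refl[OF center_invariant]
lemmas relZ_mult = rel_mult[OF center_invariant]

abbreviation relZ (infix "\<simeq>" 50) where "relZ \<equiv> rel (center Q m)"

lemma upper_center_2_inner:
  assumes x: "x \<in> upper_center Q m e 2" and k: "k \<in> H" shows "x \<simeq> k \<cdot> x"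
proof -
  have xQ: "x \<in> Q" and comm: "\<And>y. y \<in> Q \<Longrightarrow> m x y \<simeq> m y x"
    using x by (simp_all add: upper_center_2)
  have *: "\<forall>y\<in>Q. L x \<cdot> f \<cdot> y \<simeq> f \<cdot> L x \<cdot> y" if "f \<in> G" for f
    using that
  proof (induction rule: G_induct)
    case (L u)
    show ?case
    proof
      fix y assume y: "y \<in> Q"
      have "m x (m u y) \<simeq> m (m x u) y" using xQ L y by (intro relZ_sym[OF assoc_center])
      also have "\<dots> \<simeq> m (m u x) y" by (rule relZ_mult[OF comm[OF L] relZ_refl[OF y]])
      also have "\<dots> \<simeq> m u (m x y)" using xQ L y by (intro assoc_center)
      finally show "L x \<cdot> L u \<cdot> y \<simeq> L u \<cdot> L x \<cdot> y" using xQ L y by (simp add: m_L)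
    qed
  next
    case (R u)
    show ?case
    proof
      fix y assume y: "y \<in> Q"
      have "m x (m y u) \<simeq> m (m x y) u" using xQ R y by (intro relZ_sym[OF assoc_center])
      then show "L x \<cdot> R u \<cdot> y \<simeq> R u \<cdot> L x \<cdot> y"
        using xQ R y by (simp add: m_R[of _ u] m_L[of x])
    qed
  next
    case (add f g)
    show ?case
    proof
      fix y assume y: "y \<in> Q"
      have "L x \<cdot> f \<cdot> g \<cdot> y \<simeq> f \<cdot> L x \<cdot> g \<cdot> y" using add y by simp
      also have "\<dots> \<simeq> f \<cdot> g \<cdot> L x \<cdot> y"
        using add y by (intro rel_act center_invariant) simp_all
      finally show "L x \<cdot> (f + g) \<cdot> y \<simeq> (f + g) \<cdot> L x \<cdot> y" by (simp add: act_add)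
    qed
  next
    case (uminus f)
    show ?case
    proof
      fix y assume y: "y \<in> Q"
      have "L x \<cdot> f \<cdot> - f \<cdot> y \<simeq> f \<cdot> L x \<cdot> - f \<cdot> y"
        using uminus y by (simp del: act_minus)
      then have "- f \<cdot> L x \<cdot> f \<cdot> - f \<cdot> y \<simeq> - f \<cdot> f \<cdot> L x \<cdot> - f \<cdot> y"
        by (rule rel_act[OF center_invariant]) (use uminus in simp)
      then have "- f \<cdot> L x \<cdot> y \<simeq> L x \<cdot> - f \<cdot> y"
        by simp
      then show "L x \<cdot> - f \<cdot> y \<simeq> - f \<cdot> L x \<cdot> y"
        by (rule relZ_sym)
    qed
  qed
  from *[of k] k xQ have "L x \<cdot> k \<cdot> e \<simeq> k \<cdot> L x \<cdot> e" by (blast intro: H_G e_Q)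
  then show ?thesis using k xQ by simp
qed

lemma upper_center_2_invariant: "invariant_subloop (upper_center Q m e 2)"
  unfolding invariant_subloop_def
proof (intro conjI ballI)
  show "upper_center Q m e 2 \<subseteq> Q" by (auto simp: upper_center_2)
  show "e \<in> upper_center Q m e 2" by (simp add: upper_center_2 m_L relZ_refl L_e_zero)
next
  fix a b assume "a \<in> upper_center Q m e 2" "b \<in> upper_center Q m e 2"
  then have a: "a \<in> Q" "\<And>y. y \<in> Q \<Longrightarrow> m a y \<simeq> m y a" and b: "b \<in> Q" "\<And>y. y \<in> Q \<Longrightarrow> m b y \<simeq> m y b"
    by (simp_all add: upper_center_2)
  have "m (m a b) y \<simeq> m y (m a b)" if y: "y \<in> Q" for y
  proof -
    have "m (m a b) y \<simeq> m a (m b y)" using a(1) b(1) y by (intro assoc_center)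
    also have "\<dots> \<simeq> m a (m y b)" by (rule relZ_mult[OF relZ_refl[OF a(1)] b(2)[OF y]])
    also have "\<dots> \<simeq> m (m a y) b" using a(1) b(1) y by (intro relZ_sym[OF assoc_center])
    also have "\<dots> \<simeq> m (m y a) b" by (rule relZ_mult[OF a(2)[OF y] relZ_refl[OF b(1)]])
    also have "\<dots> \<simeq> m y (m a b)" using a(1) b(1) y by (intro assoc_center)
    finally show ?thesis .
  qed
  then show "L a \<cdot> b \<in> upper_center Q m e 2"
    using a(1) b(1) by (simp add: upper_center_2 m_L)
next
  fix a assume "a \<in> upper_center Q m e 2"
  then have a: "a \<in> Q" "\<And>y. y \<in> Q \<Longrightarrow> m a y \<simeq> m y a" by (simp_all add: upper_center_2)
  let ?b = "- L a \<cdot> e"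
  have b: "?b \<in> Q" using a(1) by simp
  have ab: "m a ?b = e" using a(1) by (simp add: m_L)
  have e: "m e y = y" "m y e = y" if "y \<in> Q" for y using that by (simp_all add: m_L)
  have "m ?b y \<simeq> m y ?b" if y: "y \<in> Q" for y
  proof (rule rel_cancel_left[OF center_invariant])
    have "m a (m ?b y) \<simeq> m (m a ?b) y" using a(1) b y by (intro relZ_sym[OF assoc_center])
    also have "m (m a ?b) y = m y (m a ?b)" using y by (simp add: ab e)
    also have "\<dots> \<simeq> m (m y a) ?b" using a(1) b y by (intro relZ_sym[OF assoc_center])
    also have "\<dots> \<simeq> m (m a y) ?b" by (rule relZ_mult[OF relZ_sym[OF a(2)[OF y]] relZ_refl[OF b]])
    also have "\<dots> \<simeq> m a (m y ?b)" using a(1) b y by (intro assoc_center)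
    finally show "m a (m ?b y) \<simeq> m a (m y ?b)" .
  qed (use a(1) b y in simp_all)
  then show "?b \<in> upper_center Q m e 2"
    using b by (simp add: upper_center_2)
next
  fix k a assume k: "k \<in> H" and a2: "a \<in> upper_center Q m e 2"
  then have a: "a \<in> Q" "\<And>y. y \<in> Q \<Longrightarrow> m a y \<simeq> m y a" by (simp_all add: upper_center_2)
  have ka: "a \<simeq> k \<cdot> a" using upper_center_2_inner[OF a2 k] .
  have "m (k \<cdot> a) y \<simeq> m y (k \<cdot> a)" if y: "y \<in> Q" for y
  proof -
    have "m (k \<cdot> a) y \<simeq> m a y" by (rule relZ_mult[OF relZ_sym[OF ka] relZ_refl[OF y]])
    also have "\<dots> \<simeq> m y a" using a(2) y by simp
    also have "\<dots> \<simeq> m y (k \<cdot> a)" by (rule relZ_mult[OF relZ_refl[OF y] ka])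
    finally show ?thesis .
  qed
  then show "k \<cdot> a \<in> upper_center Q m e 2"
    using a(1) k by (simp add: upper_center_2)
qed

lemma conj_center:
  assumes q: "x \<in> Q" "y \<in> Q" "u \<in> Q"
  shows "m u (m x y) \<simeq> m (m x y) (t y \<cdot> t x \<cdot> u)"
proof -
  have c: "m a (t a \<cdot> b) = m b a" if "a \<in> Q" "b \<in> Q" for a b
    using that by (simp add: m_L L_t)
  have tq: "t x \<cdot> u \<in> Q" "t y \<cdot> t x \<cdot> u \<in> Q" using q by simp_all
  have "m u (m x y) \<simeq> m (m u x) y" using q by (intro relZ_sym[OF assoc_center])
  also have "m (m u x) y = m (m x (t x \<cdot> u)) y" using q by (simp add: c)
  also have "\<dots> \<simeq> m x (m (t x \<cdot> u) y)" using q tq by (intro assoc_center)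
  also have "\<dots> = m x (m y (t y \<cdot> t x \<cdot> u))" using q tq by (simp add: c)
  also have "\<dots> \<simeq> m (m x y) (t y \<cdot> t x \<cdot> u)" using q tq by (intro relZ_sym[OF assoc_center])
  finally show ?thesis .
qed

lemma commutator_upper_center_2:
  assumes q: "x \<in> Q" "y \<in> Q" shows "rel (upper_center Q m e 2) (m x y) (m y x)"
proof -
  let ?xy = "m x y" and ?s = "- L (m x y) \<cdot> m y x"
  have s: "?s \<in> Q" "m ?xy ?s = m y x" and xy: "?xy \<in> Q" using q by (simp_all add: m_L)
  have "m ?s v \<simeq> m v ?s" if v: "v \<in> Q" for v
  proof (rule rel_cancel_left[OF center_invariant])
    let ?u = "- t x \<cdot> - t y \<cdot> v"
    have u: "?u \<in> Q" using q v by simp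
    have v1: "t y \<cdot> t x \<cdot> ?u = v" by simp
    have v2: "t x \<cdot> t y \<cdot> ?u = v"
      using H_comm_act[OF t_H[OF q(1)] t_H[OF q(2)], of ?u] by (simp only: v1)
    have "m ?xy (m ?s v) \<simeq> m (m ?xy ?s) v" using xy s v by (intro relZ_sym[OF assoc_center])
    also have "\<dots> = m (m y x) v" by (simp only: s)
    also have "\<dots> \<simeq> m ?u (m y x)"
      using conj_center[OF q(2,1) u] unfolding v2 by (rule relZ_sym)
    also have "\<dots> = m ?u (m ?xy ?s)" by (simp only: s)
    also have "\<dots> \<simeq> m (m ?u ?xy) ?s" using xy s u by (intro relZ_sym[OF assoc_center])
    also have "\<dots> \<simeq> m (m ?xy v) ?s"
      by (rule relZ_mult[OF conj_center[OF q u, unfolded v1] relZ_refl[OF s(1)]])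
    also have "\<dots> \<simeq> m ?xy (m v ?s)" using xy s v by (intro assoc_center)
    finally show "m ?xy (m ?s v) \<simeq> m ?xy (m v ?s)" .
  qed (use xy s v in simp_all)
  then have "?s \<in> upper_center Q m e 2" using s by (simp add: upper_center_2)
  then show ?thesis using q by (simp add: rel_def)
qed

lemma upper_center_3: "upper_center Q m e 3 = Q"
proof -
  have sub: "center Q m \<subseteq> upper_center Q m e 2"
  proof
    fix a assume a: "a \<in> center Q m"
    then have "a \<in> Q" by (simp add: center_iff)
    with a show "a \<in> upper_center Q m e 2"
      by (auto simp: upper_center_2 center_iff m_L intro!: relZ_refl)
  qed
  have "upper_center Q m e 3 = {x \<in> Q. central (upper_center Q m e 2) x}"
    using upper_center_Suc[of 2] upper_center_2_invariant by (simp add: numeral_3_eq_3 numeral_2_eq_2)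
  moreover have "central (upper_center Q m e 2) x" if "x \<in> Q" for x
    unfolding central_def using that commutator_upper_center_2 rel_mono[OF assoc_center sub] by simp
  ultimately show ?thesis by auto
qed

lemma nilpotent: "nilpotent_class_le Q m e 3"
  unfolding nilpotent_class_le_def using upper_center_3 by blast

end

subsection \<open>The multiplication group\<close>

typedef 'a bijection = "{f :: 'a \<Rightarrow> 'a. bij f}"
  morphisms apply_bij Abs_bij
  by (intro exI[of _ id]) simp

lemma bij_apply_bij: "bij (apply_bij f)"
  using apply_bij by blast

instantiation bijection :: (type) group_add
begin

definition "0 = Abs_bij id"
definition "f + g = Abs_bij (apply_bij f \<circ> apply_bij g)"
definition "- f = Abs_bij (inv (apply_bij f))"
definition "f - g = f + - g" for f g :: "'a bijection"

instance
proof
  fix f g k :: "'a bijection"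
  have plus: "apply_bij (f + g) = apply_bij f \<circ> apply_bij g" for f g :: "'a bijection"
    unfolding plus_bijection_def by (rule Abs_bij_inverse) (simp add: bij_comp bij_apply_bij)
  have zero: "apply_bij 0 = (id :: 'a \<Rightarrow> 'a)"
    unfolding zero_bijection_def by (rule Abs_bij_inverse) simp
  have uminus: "apply_bij (- f) = inv (apply_bij f)" for f :: "'a bijection"
    unfolding uminus_bijection_def by (rule Abs_bij_inverse) (simp add: bij_imp_bij_inv bij_apply_bij)
  show "f + g + k = f + (g + k)"
    by (simp add: plus comp_assoc flip: apply_bij_inject)
  show "0 + f = f" "f + 0 = f"
    by (simp_all add: plus zero flip: apply_bij_inject)
  show "- f + f = 0"
    by (simp add: plus zero uminus bij_is_inj[OF bij_apply_bij] flip: apply_bij_inject)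
  show "f + - g = f - g"
    by (simp add: minus_bijection_def)
qed

end

lemma apply_bij_plus: "apply_bij (f + g) = apply_bij f \<circ> apply_bij g"
  unfolding plus_bijection_def by (rule Abs_bij_inverse) (simp add: bij_comp bij_apply_bij)

lemma apply_bij_zero: "apply_bij 0 = id"
  unfolding zero_bijection_def by (rule Abs_bij_inverse) simp

lemma Abs_bij_comp: "\<lbrakk>bij f; bij g\<rbrakk> \<Longrightarrow> Abs_bij (f \<circ> g) = Abs_bij f + Abs_bij g"
  by (simp add: plus_bijection_def Abs_bij_inverse)

lemma Abs_bij_inv: "bij f \<Longrightarrow> Abs_bij (inv f) = - Abs_bij f"
  by (simp add: uminus_bijection_def Abs_bij_inverse)

lemma bij_extend:
  assumes "bij_betw f Q Q" shows "bij (\<lambda>y. if y \<in> Q then f y else y)"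
proof -
  have "bij_betw (\<lambda>y. if y \<in> Q then f y else y) Q Q"
    using assms by (simp cong: bij_betw_cong)
  moreover have "bij_betw (\<lambda>y. if y \<in> Q then f y else y) (- Q) (- Q)"
    by (rule bij_betw_cong[THEN iffD1, OF _ bij_betw_id]) simp
  ultimately show ?thesis
    using bij_betw_combine[of _ Q Q "- Q" "- Q"] by simp
qed

definition permutes_within :: "'a set \<Rightarrow> ('a \<Rightarrow> 'a) \<Rightarrow> bool" where
  "permutes_within Q f \<longleftrightarrow> bij f \<and> f ` Q = Q \<and> (\<forall>y. y \<notin> Q \<longrightarrow> f y = y)"

lemma permutes_within_extend:
  "bij_betw f Q Q \<Longrightarrow> permutes_within Q (\<lambda>y. if y \<in> Q then f y else y)"
  by (simp add: permutes_within_def bij_extend) (auto simp: bij_betw_def)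

lemma permutes_within_inv:
  assumes "permutes_within Q f" shows "perm_inv Q f = inv f" "permutes_within Q (inv f)"
proof -
  have f: "bij f" "f ` Q = Q" "\<And>y. y \<notin> Q \<Longrightarrow> f y = y" using assms by (auto simp: permutes_within_def)
  show *: "perm_inv Q f = inv f"
  proof
    fix y
    show "perm_inv Q f y = inv f y"
    proof (cases "y \<in> Q")
      case True
      then have "f (inv_into Q f y) = y" using f(2) by (simp add: f_inv_into_f)
      then have "inv f y = inv_into Q f y" using f(1) by (metis bij_inv_eq_iff)
      then show ?thesis using True by (simp add: perm_inv_def)
    next
      case False
      then have "inv f y = y" using f by (metis bij_inv_eq_iff)
      then show ?thesis using False by (simp add: perm_inv_def)
    qed
  qed
  have "inv f ` Q = Q" using f(1,2) by (metis bij_is_inj image_inv_f_f)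
  moreover have "inv f y = y" if "y \<notin> Q" for y using f that by (metis bij_inv_eq_iff)
  ultimately show "permutes_within Q (inv f)"
    using f(1) by (simp add: permutes_within_def bij_imp_bij_inv)
qed

lemma permutes_within_comp:
  assumes "permutes_within Q f" "permutes_within Q g" shows "permutes_within Q (g \<circ> f)"
  using assms unfolding permutes_within_def image_comp[symmetric] by (auto intro: bij_comp)

lemma Mlt_permutes_within:
  assumes "is_loop Q m e" "f \<in> Mlt Q m" shows "permutes_within Q f"
  using assms(2)
proof induction
  case (gen_L x)
  then show ?case
    unfolding Ltr_def using assms(1) by (intro permutes_within_extend) (simp add: is_loop_def)
next
  case (gen_R x)
  then show ?case
    unfolding Rtr_def using assms(1) by (intro permutes_within_extend) (simp add: is_loop_def)
next
  case (comp f g)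
  then show ?case
    by (intro permutes_within_comp)
next
  case (inv f)
  then show ?case
    by (simp add: permutes_within_inv)
qed

lemma aim_lc_mult_interpretation:
  fixes Q :: "'a set" and m :: "'a \<Rightarrow> 'a \<Rightarrow> 'a" and e :: 'a
  assumes "AIM_loop Q m e" and "LC_loop Q m e"
  shows "aim_lc_mult apply_bij (Abs_bij ` Mlt Q m) Q e (\<lambda>x. Abs_bij (Ltr Q m x)) (\<lambda>x. Abs_bij (Rtr Q m x)) m"
proof -
  have loop: "is_loop Q m e" using assms(1) by (simp add: AIM_loop_def)
  then have eQ: "e \<in> Q" and mQ: "\<And>x y. \<lbrakk>x \<in> Q; y \<in> Q\<rbrakk> \<Longrightarrow> m x y \<in> Q"
    and me: "\<And>x. x \<in> Q \<Longrightarrow> m e x = x" "\<And>x. x \<in> Q \<Longrightarrow> m x e = x"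
    by (auto simp: is_loop_def)
  have lc: "m x (m x (m y z)) = m (m x (m x y)) z" if "x \<in> Q" "y \<in> Q" "z \<in> Q" for x y z
    using assms(2) that by (simp add: LC_loop_def)
  note perm = Mlt_permutes_within[OF loop]
  have bij: "bij f" if "f \<in> Mlt Q m" for f using perm[OF that] by (simp add: permutes_within_def)
  have Rep: "apply_bij (Abs_bij f) = f" if "f \<in> Mlt Q m" for f
    using bij[OF that] by (simp add: Abs_bij_inverse)
  have RepL: "apply_bij (Abs_bij (Ltr Q m x)) y = m x y"
    and RepR: "apply_bij (Abs_bij (Rtr Q m x)) y = m y x" if "x \<in> Q" "y \<in> Q" for x y
    using that by (simp_all add: Rep Mlt.gen_L Mlt.gen_R) (simp_all add: Ltr_def Rtr_def)
  have eq_I: "f = g" if "f \<in> Abs_bij ` Mlt Q m" "g \<in> Abs_bij ` Mlt Q m"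
    "\<And>x. x \<in> Q \<Longrightarrow> apply_bij f x = apply_bij g x" for f g
  proof -
    have "apply_bij f x = apply_bij g x" for x
    proof (cases "x \<in> Q")
      case False
      from that(1,2) obtain f' g' where "f = Abs_bij f'" "g = Abs_bij g'" "f' \<in> Mlt Q m" "g' \<in> Mlt Q m"
        by blast
      then show ?thesis using perm[of f'] perm[of g'] False by (simp add: Rep permutes_within_def)
    qed (rule that(3))
    then show ?thesis by (metis apply_bij_inject ext)
  qed
  have plus: "f + g \<in> Abs_bij ` Mlt Q m"
    if "f \<in> Abs_bij ` Mlt Q m" "g \<in> Abs_bij ` Mlt Q m" for f g
    using that by (auto simp: bij Mlt.comp simp flip: Abs_bij_comp)
  show ?thesis
  proof unfold_locales
    show "apply_bij (f + g) x = apply_bij f (apply_bij g x)" for f g :: "'a bijection" and x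
      by (simp add: apply_bij_plus)
    show "apply_bij 0 x = x" for x :: 'a
      by (simp add: apply_bij_zero)
    show "f = g" if "f \<in> Abs_bij ` Mlt Q m" "g \<in> Abs_bij ` Mlt Q m"
      "\<And>x. x \<in> Q \<Longrightarrow> apply_bij f x = apply_bij g x" for f g
      using that by (rule eq_I)
    show "f + g \<in> Abs_bij ` Mlt Q m"
      if "f \<in> Abs_bij ` Mlt Q m" "g \<in> Abs_bij ` Mlt Q m" for f g
      using that by (rule plus)
    have uminus: "- Abs_bij f = Abs_bij (perm_inv Q f)" if "f \<in> Mlt Q m" for f
      using that by (simp add: permutes_within_inv[OF perm] Abs_bij_inv bij)
    then show "- f \<in> Abs_bij ` Mlt Q m" if "f \<in> Abs_bij ` Mlt Q m" for f
      using that by (auto intro: Mlt.inv)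
    show "apply_bij g x \<in> Q" if "g \<in> Abs_bij ` Mlt Q m" "x \<in> Q" for g x
      using that perm by (fastforce simp: Rep permutes_within_def)
    show "e \<in> Q" by (rule eQ)
    show L: "Abs_bij (Ltr Q m x) \<in> Abs_bij ` Mlt Q m" and R: "Abs_bij (Rtr Q m x) \<in> Abs_bij ` Mlt Q m"
      if "x \<in> Q" for x
      using that by (auto intro: Mlt.gen_L Mlt.gen_R)
    show "apply_bij (Abs_bij (Ltr Q m x)) y = apply_bij (Abs_bij (Rtr Q m y)) x" if "x \<in> Q" "y \<in> Q" for x y
      using that by (simp add: RepL RepR)
    show "apply_bij (Abs_bij (Ltr Q m x)) e = x" "apply_bij (Abs_bij (Rtr Q m x)) e = x" if "x \<in> Q" for x
      using that by (simp_all add: RepL RepR me eQ)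
    show "P g"
      if g: "g \<in> Abs_bij ` Mlt Q m" and PL: "\<And>x. x \<in> Q \<Longrightarrow> P (Abs_bij (Ltr Q m x))"
        and PR: "\<And>x. x \<in> Q \<Longrightarrow> P (Abs_bij (Rtr Q m x))"
        and Pplus: "\<And>f g. \<lbrakk>f \<in> Abs_bij ` Mlt Q m; g \<in> Abs_bij ` Mlt Q m; P f; P g\<rbrakk> \<Longrightarrow> P (f + g)"
        and Pminus: "\<And>f. \<lbrakk>f \<in> Abs_bij ` Mlt Q m; P f\<rbrakk> \<Longrightarrow> P (- f)" for P g
    proof -
      have "P (Abs_bij f)" if "f \<in> Mlt Q m" for f
        using that
      proof induction
        case (comp f g)
        then show ?case using Pplus[of "Abs_bij g" "Abs_bij f"] Abs_bij_comp[OF bij bij, of g f] by (simp add: o_def)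
      next
        case (inv f)
        then show ?case using Pminus[of "Abs_bij f"] by (simp add: uminus)
      qed (use PL PR in auto)
      then show ?thesis using g by auto
    qed
    show "f + g = g + f"
      if "f \<in> Abs_bij ` Mlt Q m" "g \<in> Abs_bij ` Mlt Q m" "apply_bij f e = e" "apply_bij g e = e" for f g
    proof -
      from that(1,2) obtain f' g'
        where fg: "f = Abs_bij f'" "g = Abs_bij g'" "f' \<in> Mlt Q m" "g' \<in> Mlt Q m"
        by blast
      then have "f' \<circ> g' = g' \<circ> f'"
        using assms(1) that by (simp add: AIM_loop_def Inn_def Rep)
      then show ?thesis using fg by (simp add: bij flip: Abs_bij_comp)
    qed
    show "Abs_bij (Ltr Q m (apply_bij (Abs_bij (Ltr Q m x)) x)) = Abs_bij (Ltr Q m x) + Abs_bij (Ltr Q m x)"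
      if x: "x \<in> Q" for x
    proof (rule eq_I)
      fix y assume y: "y \<in> Q"
      have "m (m x x) y = m x (m x y)"
        using lc[OF x eQ y] x y by (simp add: me)
      then show "apply_bij (Abs_bij (Ltr Q m (apply_bij (Abs_bij (Ltr Q m x)) x))) y
          = apply_bij (Abs_bij (Ltr Q m x) + Abs_bij (Ltr Q m x)) y"
        using x y by (simp add: RepL apply_bij_plus mQ)
    qed (use x in \<open>simp_all add: L plus RepL mQ\<close>)
    show "Abs_bij (Ltr Q m x) + Abs_bij (Ltr Q m x) + Abs_bij (Rtr Q m y)
        = Abs_bij (Rtr Q m y) + Abs_bij (Ltr Q m x) + Abs_bij (Ltr Q m x)" if "x \<in> Q" "y \<in> Q" for x y
      by (rule eq_I) (use that lc in \<open>simp_all add: L R plus apply_bij_plus RepL RepR mQ\<close>)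
    show "m x y = apply_bij (Abs_bij (Ltr Q m x)) y" if "x \<in> Q" "y \<in> Q" for x y
      using that by (simp add: RepL)
  qed
qed

theorem theorem1:
  fixes Q :: "'a set" and m :: "'a \<Rightarrow> 'a \<Rightarrow> 'a" and e :: 'a
  assumes "AIM_loop Q m e" and "LC_loop Q m e"
  shows "normal_subloop Q m e (nucleus Q m)
    \<and> is_abelian_group_loop (qcarrier Q m (nucleus Q m)) (qmult m (nucleus Q m)) (nucleus Q m)
    \<and> is_group_loop (qcarrier Q m (center Q m)) (qmult m (center Q m)) (center Q m)
    \<and> nilpotent_class_le Q m e 3"
proof -
  interpret aim_lc_mult apply_bij "Abs_bij ` Mlt Q m" Q e
    "\<lambda>x. Abs_bij (Ltr Q m x)" "\<lambda>x. Abs_bij (Rtr Q m x)" m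
    using assms by (rule aim_lc_mult_interpretation)
  have "\<phi> ` nucleus Q m = nucleus Q m" if "\<phi> \<in> Inn Q m e" for \<phi>
  proof -
    have "is_loop Q m e" using assms(1) by (simp add: AIM_loop_def)
    then have "bij \<phi>"
      using Mlt_permutes_within[of Q m e \<phi>] that by (simp add: Inn_def permutes_within_def)
    then have \<phi>: "apply_bij (Abs_bij \<phi>) = \<phi>" by (simp add: Abs_bij_inverse)
    then have k: "Abs_bij \<phi> \<in> H" "- Abs_bij \<phi> \<in> H"
      using that by (auto simp: Inn_def intro!: H_mem H_uminus)
    show ?thesis
    proof (intro equalityI subsetI)
      fix a assume a: "a \<in> nucleus Q m"
      have "a = \<phi> (apply_bij (- Abs_bij \<phi>) a)"
        using act_minus(2)[of "Abs_bij \<phi>" a] by (simp add: \<phi>)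
      moreover have "apply_bij (- Abs_bij \<phi>) a \<in> nucleus Q m"
        using nucleus_invariant a k(2) by (rule invariant_H)
      ultimately show "a \<in> \<phi> ` nucleus Q m" by (rule image_eqI)
    qed (use invariant_H[OF nucleus_invariant _ k(1)] in \<open>auto simp: \<phi>\<close>)
  qed
  then show ?thesis
    unfolding normal_subloop_def
    using subloop_invariant[OF nucleus_invariant] nucleus_quotient center_quotient_group nilpotent by blast
qed

end
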